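(* Let $\beta\in\mathbb{R}$ and $y\in[0,1]$. For $N\ge 1$ let $\pi$ be a random permutation in $S_N$ with law $\mathbb{P}_N^{1-\beta/N}$, and let $\eta^{(\lfloor yN\rfloor,\lceil(1-y)N\rceil)}=(\eta_1,\dots,\eta_N)\in\{0,1\}^N$ be the random particle configuration with $\eta_i=1$ if $\pi_i\le\lfloor yN\rfloor$ and $\eta_i=0$ otherwise. Then for every continuous function $f:[0,1]\to\mathbb{R}$, $$ \lim_{\epsilon\downarrow0}\ \lim_{N\to\infty}\ \mathbb{P}_N^{1-\beta/N}\left\{\left|\frac1N\sum_{i=1}^N f(i/N)\,\eta^{(\lfloor yN\rfloor,\lceil(1-y)N\rceil)}_i-\int_0^1 f(x)\,\rho(x;y)\,dx\right|>\epsilon\right\}=0, $$ where $\rho(x;y)=\int_0^y u(x,y')\,dy'$ with $$ u(x,y)=\frac{(\beta/2)\sinh(\beta/2)}{\big(e^{\beta/4}\cosh(\beta[x-y]/2)-e^{-\beta/4}\cosh(\beta[x+y-1]/2)\big)^2}. $$ Moreover, $$ \rho(x;y)=\frac{(1-e^{-\beta y})e^{-\beta x}}{(1-e^{-\beta})-(1-e^{-\beta x})(1-e^{-\beta y})}=\frac{e^{\beta(\frac12-x)/2}\sinh(\beta y/2)}{e^{\beta/4}\cosh(\beta[x-y]/2)-e^{-\beta/4}\cosh(\beta[x+y-1]/2)}. $$ For $\beta=0$ these expressions are understood as their limits $\beta\to0$, i.e. $u\equiv1$ and $\rho(x;y)=y$.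
   Context: For $q>0$ and $N\ge1$, the Mallows measure $\mathbb{P}_N^q$ is the probability measure on the symmetric group $S_N$ given by $\mathbb{P}_N^q(\pi)=q^{d(\pi,e)}/P_N(q)$, where $d(\pi,e)=|\{(i,j)\in\mathbb{Z}^2:1\le i<j\le N,\ \pi_i>\pi_j\}|$ is the number of inversions of $\pi=(\pi_1,\dots,\pi_N)$ and $P_N(q)=\sum_{\pi\in S_N}q^{d(\pi,e)}$. For given $\beta$, the measure $\mathbb{P}_N^{1-\beta/N}$ is considered for $N$ large enough that $1-\beta/N>0$. (The configuration $\eta$ is $(\xi_{\pi_1},\dots,\xi_{\pi_N})$ with $\xi=(1,\dots,1,0,\dots,0)$ having $\lfloor yN\rfloor$ ones; its law is the invariant measure, with $\lfloor yN\rfloor$ particles, of the asymmetric exclusion process on $\{1,\dots,N\}$ with hopping rate $p$ to the left and $1-p$ to the right, where $(1-p)/p=1-\beta/N$. This interpretation is not needed for the statement.) *)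

theory Defs
  imports "HOL-Probability.Probability" "HOL-Combinatorics.Permutations"
begin

text \<open>
  Elements of \<open>S\<^sub>N\<close> are functions on \<^typ>\<open>nat\<close> that permute \<open>{1..N}\<close> (and fix everything else).
\<close>

definition inversions :: "nat \<Rightarrow> (nat \<Rightarrow> nat) \<Rightarrow> nat" where
  "inversions N \<pi> = card {(i, j). 1 \<le> i \<and> i < j \<and> j \<le> N \<and> \<pi> i > \<pi> j}"

definition mallows_norm :: "nat \<Rightarrow> real \<Rightarrow> real" where
  "mallows_norm N q = (\<Sum>\<pi> | \<pi> permutes {1..N}. q ^ inversions N \<pi>)"

text \<open>
  This is the Mallows measure only for \<open>q > 0\<close>; for other \<open>q\<close> the value is irrelevant.
\<close>

definition mallows :: "nat \<Rightarrow> real \<Rightarrow> (nat \<Rightarrow> nat) measure" where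
  "mallows N q = point_measure {\<pi>. \<pi> permutes {1..N}}
     (\<lambda>\<pi>. ennreal (q ^ inversions N \<pi> / mallows_norm N q))"

lemma prob_space_mallows:
  assumes "q > 0"
  shows "prob_space (mallows N q)"
proof -
  let ?S = "{\<pi>. \<pi> permutes {1..N}}"
  have fin: "finite ?S" by (simp add: finite_permutations)
  have ne: "?S \<noteq> {}" using permutes_id by blast
  have pos: "mallows_norm N q > 0"
    unfolding mallows_norm_def by (rule sum_pos) (use fin ne assms in auto)
  have "(\<Sum>\<pi>\<in>?S. ennreal (q ^ inversions N \<pi> / mallows_norm N q))
      = ennreal (\<Sum>\<pi>\<in>?S. q ^ inversions N \<pi> / mallows_norm N q)"
    by (rule sum_ennreal) (use pos assms in auto)
  also have "(\<Sum>\<pi>\<in>?S. q ^ inversions N \<pi> / mallows_norm N q) = 1"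
    using pos by (simp add: mallows_norm_def flip: sum_divide_distrib)
  finally show ?thesis
    unfolding mallows_def using fin ne by (intro prob_space_point_measure) auto
qed

text \<open>The configuration with \<open>k\<close> particles; its \<open>i\<close>-th entry is a number in \<open>{0, 1}\<close>.\<close>

definition particle_config :: "nat \<Rightarrow> (nat \<Rightarrow> nat) \<Rightarrow> nat \<Rightarrow> real" where
  "particle_config k \<pi> i = (if \<pi> i \<le> k then 1 else 0)"

text \<open>At \<open>\<beta> = 0\<close> the formula would read \<open>0 / 0\<close>, so its limit as \<open>\<beta> \<rightarrow> 0\<close> is used there.\<close>

definition mallows_u :: "real \<Rightarrow> real \<Rightarrow> real \<Rightarrow> real" where
  "mallows_u \<beta> x y =
     (if \<beta> = 0 then 1
      else (\<beta> / 2) * sinh (\<beta> / 2) /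
           (exp (\<beta> / 4) * cosh (\<beta> * (x - y) / 2)
            - exp (- \<beta> / 4) * cosh (\<beta> * (x + y - 1) / 2)) ^ 2)"

definition mallows_rho :: "real \<Rightarrow> real \<Rightarrow> real \<Rightarrow> real" where
  "mallows_rho \<beta> x y = integral {0..y} (\<lambda>y'. mallows_u \<beta> x y')"

end

theory Submission
  imports Defs "HOL-Real_Asymp.Real_Asymp"
begin

text \<open>
  Let \<open>m\<close> be the number of particles among the last \<open>n\<close> sites and \<open>[m] = 1 + r + \<dots> + r\<^bsup>m-1\<^esup>\<close> with
  \<open>r = 1/q\<close>. Revealing \<open>\<pi>\<^sub>1, \<pi>\<^sub>2, \<dots>\<close> one after the other, a state with \<open>m\<close> particles on \<open>n\<close>
  remaining sites places a particle next with probability \<open>(1 - q\<^bsup>m\<^esup>)/(1 - q\<^bsup>n\<^esup>)\<close>, which makes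
  both \<open>[m]/[n]\<close> and \<open>[m]([m] - 1)/([n]([n] - 1))\<close> martingales. Hence the first two moments of
  \<open>[m]\<close> are explicit, its variance is \<open>o(N\<^sup>2)\<close>, and \<open>[m]/N\<close>, therefore also \<open>m/N\<close>, converges in
  mean for \<open>q = 1 - \<beta>/N\<close>. The derivative of the limiting particle profile is \<open>\<rho>\<close>, and a Riemann
  sum argument gives the convergence for continuous test functions.
\<close>

section \<open>Sequential construction of permutations\<close>

text \<open>Passing from \<open>q\<close> to \<open>r = 1/q\<close> produces the martingales for the
  following reason. The next site carries a particle with weight \<open>qint q m\<close> out of
  \<open>qint q n\<close>, and then \<open>qint r m\<close> drops by \<open>r ^ (m - 1)\<close>.
  Since \<open>qint q m * r ^ (m - 1) = qint r m\<close>, the expected drop is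
  \<open>qint r m / qint q n\<close>, proportional to the current value. The same happens for
  \<open>[m]([m] - 1) = r [m][m - 1]\<close>, the analogue of the falling factorial, with the extra
  factor \<open>1 + q\<close>. Two such eigenfunctions already give a variance, so the law of
  \<open>m\<close> is never computed.

  Conditional probabilities are avoided by working with unnormalised sums over the permutations of
  \<open>{l..N}\<close>: after a value is removed, the others are relabelled as
  \<open>{Suc l..N}\<close>, the particles are always the values up to a threshold, and only this
  threshold moves.

  The denominators of the two martingales vanish when too few sites are left, which forces
  \<open>x < 1\<close> in the moment computation. Inverting \<open>m \<mapsto> [m]\<close> costs
  only a constant, because \<open>r ^ N\<close> tends to \<open>exp \<beta>\<close> and so stays
  away from 0.\<close>

definition inversions_on :: "nat set \<Rightarrow> (nat \<Rightarrow> nat) \<Rightarrow> nat" where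
  "inversions_on A \<pi> = card {(i, j). i \<in> A \<and> j \<in> A \<and> i < j \<and> \<pi> i > \<pi> j}"

lemma inversions_eq: "inversions N \<pi> = inversions_on {1..N} \<pi>"
  unfolding inversions_def inversions_on_def by (rule arg_cong[where f = card]) auto

text \<open>
  The cycle moving \<open>a\<close> to position \<open>l\<close> and keeping the relative order of the other values; every
  permutation of \<open>{l..N}\<close> is uniquely \<open>pull_front l a \<circ> \<sigma>\<close> with \<open>\<sigma>\<close> a permutation of \<open>{Suc l..N}\<close>.
\<close>

definition pull_front :: "nat \<Rightarrow> nat \<Rightarrow> nat \<Rightarrow> nat" where
  "pull_front l a v = (if v = l then a else if l < v \<and> v \<le> a then v - 1 else v)"

lemma pull_front_permutes:
  assumes "l \<le> a" "a \<le> N"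
  shows "pull_front l a permutes {l..N}"
proof (rule bij_imp_permutes)
  have inj: "inj_on (pull_front l a) {l..N}"
    unfolding inj_on_def pull_front_def by (auto split: if_splits)
  moreover have "pull_front l a ` {l..N} \<subseteq> {l..N}"
    using assms by (auto simp: pull_front_def)
  ultimately show "bij_betw (pull_front l a) {l..N} {l..N}"
    by (simp add: bij_betw_def endo_inj_surj)
qed (use assms in \<open>auto simp: pull_front_def\<close>)

lemma pull_front_less_iff:
  "l < v \<Longrightarrow> l < w \<Longrightarrow> pull_front l a v < pull_front l a w \<longleftrightarrow> v < w"
  by (auto simp: pull_front_def)

text \<open>Values up to \<open>a\<close> are shifted down by one. If \<open>a > k\<close>, the
  removed value is a hole and the threshold has to move to \<open>Suc k\<close> to keep the number
  of particles; if \<open>a \<le> k\<close>, keeping the threshold drops exactly one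
  particle.\<close>

lemma pull_front_le_iff:
  assumes "l < v" "l \<le> a"
  shows "pull_front l a v \<le> k \<longleftrightarrow> v \<le> (if a \<le> k then k else Suc k)"
  using assms by (auto simp: pull_front_def)

lemma bij_betw_pull_front:
  assumes "l \<le> N"
  shows "bij_betw (\<lambda>(a, \<sigma>). pull_front l a \<circ> \<sigma>)
           ({l..N} \<times> {\<sigma>. \<sigma> permutes {Suc l..N}}) {\<pi>. \<pi> permutes {l..N}}"
proof (rule bij_betwI')
  fix z w assume z: "z \<in> {l..N} \<times> {\<sigma>. \<sigma> permutes {Suc l..N}}"
    and w: "w \<in> {l..N} \<times> {\<sigma>. \<sigma> permutes {Suc l..N}}"
  obtain a \<sigma> b \<tau> where zw: "z = (a, \<sigma>)" "w = (b, \<tau>)" by fastforce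
  have fixes_l: "\<sigma> l = l" "\<tau> l = l"
    using z w zw by (auto intro!: permutes_not_in)
  have "z = w" if eq: "pull_front l a \<circ> \<sigma> = pull_front l b \<circ> \<tau>"
  proof -
    have ab: "a = b"
      using fun_cong[OF eq, of l] fixes_l by (simp add: pull_front_def)
    have "inj (pull_front l a)"
      using z zw by (intro permutes_inj[OF pull_front_permutes[of l a N]]) auto
    then have "\<sigma> = \<tau>"
      using eq ab by (metis fun.inj_map_strong comp_apply ext injD)
    with ab zw show ?thesis by simp
  qed
  then show "((case z of (a, \<sigma>) \<Rightarrow> pull_front l a \<circ> \<sigma>) = (case w of (a, \<sigma>) \<Rightarrow> pull_front l a \<circ> \<sigma>)) = (z = w)"
    using zw by auto
next
  fix z assume "z \<in> {l..N} \<times> {\<sigma>. \<sigma> permutes {Suc l..N}}"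
  then show "(case z of (a, \<sigma>) \<Rightarrow> pull_front l a \<circ> \<sigma>) \<in> {\<pi>. \<pi> permutes {l..N}}"
    by (auto intro!: permutes_compose pull_front_permutes intro: permutes_subset)
next
  fix \<pi> assume "\<pi> \<in> {\<pi>. \<pi> permutes {l..N}}"
  then have \<pi>: "\<pi> permutes {l..N}" by simp
  define a where "a = \<pi> l"
  have a: "a \<in> {l..N}"
    using permutes_in_image[OF \<pi>, of l] assms by (simp add: a_def)
  then have c: "pull_front l a permutes {l..N}" by (intro pull_front_permutes) auto
  define \<sigma> where "\<sigma> = inv (pull_front l a) \<circ> \<pi>"
  have \<sigma>: "\<sigma> permutes {l..N}"
    unfolding \<sigma>_def by (intro permutes_compose \<pi> permutes_inv c)
  have "pull_front l a l = a" by (simp add: pull_front_def)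
  then have "\<sigma> l = l"
    unfolding \<sigma>_def using permutes_inverses(2)[OF c, of l] by (simp add: a_def)
  moreover have "x = l" if "x \<in> {l..N} - {Suc l..N}" for x using that by auto
  ultimately have "\<sigma> permutes {Suc l..N}"
    by (intro permutes_superset[OF \<sigma>]) blast
  moreover have "pull_front l a \<circ> \<sigma> = \<pi>"
    unfolding \<sigma>_def by (simp add: fun_eq_iff permutes_inverses(1)[OF c])
  ultimately show "\<exists>z\<in>{l..N} \<times> {\<sigma>. \<sigma> permutes {Suc l..N}}. \<pi> = (case z of (a, \<sigma>) \<Rightarrow> pull_front l a \<circ> \<sigma>)"
    using a by (intro bexI[of _ "(a, \<sigma>)"]) auto
qed

text \<open>Site \<open>l\<close> is inverted with exactly those later sites that carry one of the
  \<open>a - l\<close> smaller values. On the later sites \<open>pull_front l a\<close> preserves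
  the order, so their inversions are those of \<open>\<sigma>\<close>. Thus the value at site
  \<open>l\<close> has a truncated geometric weight.\<close>

lemma inversions_on_pull_front:
  assumes a: "a \<in> {l..N}" and \<sigma>: "\<sigma> permutes {Suc l..N}"
  shows "inversions_on {l..N} (pull_front l a \<circ> \<sigma>) = (a - l) + inversions_on {Suc l..N} \<sigma>"
proof -
  let ?\<pi> = "pull_front l a \<circ> \<sigma>"
  have \<sigma>l: "\<sigma> l = l" using \<sigma> by (auto intro!: permutes_not_in)
  have in_iff: "\<sigma> j \<in> {Suc l..N} \<longleftrightarrow> j \<in> {Suc l..N}" for j
    using permutes_in_image[OF \<sigma>] .
  \<comment> \<open>The value \<open>v = a\<close> counts as well, since it is shifted to
    \<open>a - 1\<close>; hence the non-strict inequality on the right.\<close>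
  have below: "pull_front l a v < a \<longleftrightarrow> v \<le> a" if "l < v" for v
    using that a by (auto simp: pull_front_def)
  let ?J = "{j \<in> {Suc l..N}. \<sigma> j \<le> a}"
  let ?K = "{(i, j). i \<in> {Suc l..N} \<and> j \<in> {Suc l..N} \<and> i < j \<and> \<sigma> i > \<sigma> j}"
  have "{(i, j). i \<in> {l..N} \<and> j \<in> {l..N} \<and> i < j \<and> ?\<pi> i > ?\<pi> j} = Pair l ` ?J \<union> ?K" (is "?L = _")
  proof (intro set_eqI)
    fix z :: "nat \<times> nat" obtain i j where z: "z = (i, j)" by fastforce
    show "z \<in> ?L \<longleftrightarrow> z \<in> Pair l ` ?J \<union> ?K"
    proof (cases "j \<in> {Suc l..N}")
      case j: True
      then have sj: "l < \<sigma> j" using in_iff[of j] by auto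
      show ?thesis
      proof (cases "i = l")
        case True
        then show ?thesis
          using j sj below[OF sj] \<sigma>l z by (auto simp: pull_front_def[of l a l])
      next
        case False
        then have "l < \<sigma> i" if "i \<in> {l..N}" using that in_iff[of i] by auto
        then show ?thesis
          using False j sj z pull_front_less_iff[of l "\<sigma> j" "\<sigma> i" a] by auto
      qed
    qed (use z in auto)
  qed
  moreover have "finite ?K"
    by (rule finite_subset[of _ "{Suc l..N} \<times> {Suc l..N}"]) auto
  moreover have "Pair l ` ?J \<inter> ?K = {}" by auto
  ultimately have "inversions_on {l..N} ?\<pi> = card (Pair l ` ?J) + card ?K"
    unfolding inversions_on_def by (simp add: card_Un_disjoint)
  also have "card (Pair l ` ?J) = card ?J" by (intro card_image inj_onI) auto
  also have "?J = \<sigma> -` {Suc l..a} \<inter> {Suc l..N}"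
  proof -
    have "\<sigma> j \<le> a \<longleftrightarrow> \<sigma> j \<in> {Suc l..a}" if "j \<in> {Suc l..N}" for j
      using in_iff[of j] that by auto
    then show ?thesis by blast
  qed
  also have "card \<dots> = card {Suc l..a}"
  proof -
    have "\<sigma> ` (\<sigma> -` {Suc l..a} \<inter> {Suc l..N}) = {Suc l..a}"
    proof -
      have "{Suc l..a} \<subseteq> \<sigma> ` {Suc l..N}"
        using permutes_image[OF \<sigma>] a by auto
      then show ?thesis by auto
    qed
    then show ?thesis
      by (metis card_image permutes_inj_on[OF \<sigma>])
  qed
  finally show ?thesis using a by (simp add: inversions_on_def)
qed

text \<open>Unnormalised expectation of \<open>g\<close> of the number of particles beyond site
  \<open>i\<close>, once the sites before \<open>l\<close> are filled. The remaining values are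
  relabelled as \<open>{l..N}\<close> and the particles are those up to \<open>k\<close>, so
  \<open>Suc k - l\<close> particles are left on \<open>Suc N - l\<close> sites.\<close>

definition weighted_count :: "nat \<Rightarrow> nat \<Rightarrow> real \<Rightarrow> (nat \<Rightarrow> real) \<Rightarrow> nat \<Rightarrow> nat \<Rightarrow> real" where
  "weighted_count N i q g l k =
     (\<Sum>\<pi> | \<pi> permutes {l..N}. q ^ inversions_on {l..N} \<pi> * g (card {j \<in> {Suc i..N}. \<pi> j \<le> k}))"

text \<open>Site \<open>l \<le> i\<close> is not among the counted sites \<open>{Suc i..N}\<close>,
  so its value \<open>a\<close> acts only through its weight and through the new threshold.\<close>

lemma weighted_count_rec:
  assumes "l \<le> i" "i \<le> N"
  shows "weighted_count N i q g l k =
    (\<Sum>a=l..N. q ^ (a - l) * weighted_count N i q g (Suc l) (if a \<le> k then k else Suc k))"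
proof -
  have "l \<le> N" using assms by simp
  have "weighted_count N i q g l k =
      (\<Sum>(a, \<sigma>) \<in> {l..N} \<times> {\<sigma>. \<sigma> permutes {Suc l..N}}.
         q ^ inversions_on {l..N} (pull_front l a \<circ> \<sigma>)
           * g (card {j \<in> {Suc i..N}. (pull_front l a \<circ> \<sigma>) j \<le> k}))"
    unfolding weighted_count_def
    by (subst sum.reindex_bij_betw[OF bij_betw_pull_front[OF \<open>l \<le> N\<close>], symmetric])
       (simp add: case_prod_unfold)
  also have "\<dots> = (\<Sum>(a, \<sigma>) \<in> {l..N} \<times> {\<sigma>. \<sigma> permutes {Suc l..N}}.
         q ^ (a - l) * (q ^ inversions_on {Suc l..N} \<sigma>
           * g (card {j \<in> {Suc i..N}. \<sigma> j \<le> (if a \<le> k then k else Suc k)})))"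
  proof (intro sum.cong refl, clarify)
    fix a \<sigma> assume a: "a \<in> {l..N}" and \<sigma>: "\<sigma> permutes {Suc l..N}"
    have "pull_front l a (\<sigma> j) \<le> k \<longleftrightarrow> \<sigma> j \<le> (if a \<le> k then k else Suc k)" if "j \<in> {Suc i..N}" for j
    proof (rule pull_front_le_iff)
      show "l < \<sigma> j" using permutes_in_image[OF \<sigma>, of j] that assms by auto
    qed (use a in auto)
    then have "{j \<in> {Suc i..N}. (pull_front l a \<circ> \<sigma>) j \<le> k}
        = {j \<in> {Suc i..N}. \<sigma> j \<le> (if a \<le> k then k else Suc k)}" by auto
    then show "q ^ inversions_on {l..N} (pull_front l a \<circ> \<sigma>)
           * g (card {j \<in> {Suc i..N}. (pull_front l a \<circ> \<sigma>) j \<le> k})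
         = q ^ (a - l) * (q ^ inversions_on {Suc l..N} \<sigma>
           * g (card {j \<in> {Suc i..N}. \<sigma> j \<le> (if a \<le> k then k else Suc k)}))"
      by (simp add: inversions_on_pull_front[OF a \<sigma>] power_add)
  qed
  also have "\<dots> = (\<Sum>a=l..N. q ^ (a - l) * weighted_count N i q g (Suc l) (if a \<le> k then k else Suc k))"
    unfolding weighted_count_def sum_distrib_left by (rule sum.cartesian_product[symmetric])
  finally show ?thesis .
qed

section \<open>Moments of q-integers\<close>

definition qint :: "real \<Rightarrow> nat \<Rightarrow> real" where
  "qint r m = (\<Sum>j<m. r ^ j)"

lemma qint_0 [simp]: "qint r 0 = 0"
  by (simp add: qint_def)

lemma qint_Suc: "qint r (Suc m) = 1 + r * qint r m"
  unfolding qint_def by (subst sum.lessThan_Suc_shift) (simp add: sum_distrib_left)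

text \<open>The geometric sum without a division by \<open>r - 1\<close>, so that the martingale
  identities below cover \<open>r = 1\<close> too.\<close>

lemma power_eq_qint: "r ^ m = 1 + (r - 1) * qint r m"
proof (induction m)
  case (Suc m)
  have "r ^ Suc m = r * (1 + (r - 1) * qint r m)" by (simp flip: Suc)
  then show ?case by (simp add: qint_Suc algebra_simps)
qed simp

lemma qint_pos: "r > 0 \<Longrightarrow> m > 0 \<Longrightarrow> qint r m > 0"
  unfolding qint_def by (intro sum_pos) auto

lemma sum_power_diff_eq_qint: "(\<Sum>a=l..<l+m. q ^ (a - l)) = qint q m"
  unfolding qint_def
  by (rule sum.reindex_bij_witness[of _ "\<lambda>j. j + l" "\<lambda>a. a - l"]) auto

text \<open>The summand depends on \<open>a\<close> only through its weight and the comparison with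
  \<open>k\<close>, so the sum collapses to the two transitions of the chain: a particle or a hole
  at site \<open>l\<close>. The bound \<open>l \<le> Suc k\<close> admits the state without
  particles, where the first group is empty.\<close>

lemma weighted_count_split:
  assumes "l \<le> i" "i \<le> N" "l \<le> Suc k" "k \<le> N"
  shows "weighted_count N i q g l k =
    qint q (Suc k - l) * weighted_count N i q g (Suc l) k
    + (qint q (Suc N - l) - qint q (Suc k - l)) * weighted_count N i q g (Suc l) (Suc k)"
proof -
  let ?W = "weighted_count N i q g (Suc l)"
  have un: "{l..N} = {l..<Suc k} \<union> {Suc k..N}" using assms by auto
  have s1: "(\<Sum>a=l..<Suc k. q ^ (a - l)) = qint q (Suc k - l)"
    using sum_power_diff_eq_qint[of q l "Suc k - l"] assms by simp
  have "(\<Sum>a=l..N. q ^ (a - l)) = qint q (Suc N - l)"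
    using sum_power_diff_eq_qint[of q l "Suc N - l"] assms by (simp add: atLeastLessThanSuc_atLeastAtMost)
  moreover have "(\<Sum>a=l..N. q ^ (a - l)) = (\<Sum>a=l..<Suc k. q ^ (a - l)) + (\<Sum>a=Suc k..N. q ^ (a - l))"
    unfolding un by (rule sum.union_disjoint) auto
  ultimately have s2: "(\<Sum>a=Suc k..N. q ^ (a - l)) = qint q (Suc N - l) - qint q (Suc k - l)"
    using s1 by linarith
  have "weighted_count N i q g l k =
      (\<Sum>a=l..<Suc k. q ^ (a - l) * ?W k) + (\<Sum>a=Suc k..N. q ^ (a - l) * ?W (Suc k))"
    unfolding weighted_count_rec[OF assms(1,2)] un
    by (subst sum.union_disjoint) (auto intro!: arg_cong2[where f = "(+)"] sum.cong)
  then show ?thesis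
    by (simp only: s1 s2 flip: sum_distrib_right)
qed

text \<open>
  Hypothesis \<open>rec\<close> says that \<open>g m / h n\<close> is a martingale of the sequential construction; it is
  multiplied out to avoid division.
\<close>

lemma weighted_count_eq:
  assumes "i \<le> N" "l \<le> Suc i" "l \<le> Suc k" "k \<le> N"
    and rec: "\<And>m n. m \<le> n \<Longrightarrow> h n * (qint q m * g (m - 1) + (qint q n - qint q m) * g m)
                 = qint q n * g m * h (n - 1)"
    and nz: "\<And>n. n \<ge> N - i \<Longrightarrow> h n \<noteq> 0"
  shows "h (Suc N - l) * weighted_count N i q g l k
       = g (Suc k - l) * h (N - i) * weighted_count N i q (\<lambda>_. 1) l k"
  using assms(2-4)
proof (induction arbitrary: k rule: inc_induct)
  case base
  \<comment> \<open>All remaining sites are counted at this stage, so the count is the same for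
    every permutation.\<close>
  have "card {j \<in> {Suc i..N}. \<pi> j \<le> k} = k - i" if \<pi>: "\<pi> permutes {Suc i..N}" for \<pi>
  proof -
    have "\<pi> ` {j \<in> {Suc i..N}. \<pi> j \<le> k} = {v \<in> \<pi> ` {Suc i..N}. v \<le> k}" by auto
    also have "\<dots> = {Suc i..k}" unfolding permutes_image[OF \<pi>] using base by auto
    finally have "card {Suc i..k} = card {j \<in> {Suc i..N}. \<pi> j \<le> k}"
      by (metis card_image permutes_inj_on[OF \<pi>])
    then show ?thesis by simp
  qed
  then have "weighted_count N i q g (Suc i) k = g (k - i) * weighted_count N i q (\<lambda>_. 1) (Suc i) k"
    unfolding weighted_count_def sum_distrib_left by (intro sum.cong) auto
  then show ?case by simp
next
  case (step l)
  let ?W = "weighted_count N i q g (Suc l)" and ?P = "weighted_count N i q (\<lambda>_. 1)"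
  define m n where "m = Suc k - l" and "n = Suc N - l"
  have mn: "m \<le> n" using step.prems by (simp add: m_def n_def)
  have n1: "n - 1 = Suc N - Suc l" "n - 1 \<ge> N - i" using step.hyps step.prems assms(1) by (auto simp: n_def)
  have P_indep: "?P l' k' = ?P l' k" for l' k' unfolding weighted_count_def by simp
  \<comment> \<open>Without remaining particles the induction hypothesis does not apply to the
    threshold \<open>k\<close>, but then the weight \<open>qint q m\<close> is 0. In the same way
    \<open>hi\<close> has weight 0 when no hole remains.\<close>
  have lo: "qint q m * (h (n - 1) * ?W k) = qint q m * (g (m - 1) * h (N - i) * ?P (Suc l) k)"
  proof (cases "m = 0")
    case False
    then have "Suc l \<le> Suc k" by (simp add: m_def)
    from step.IH[OF this] step.prems show ?thesis
      unfolding n1(1) by (simp add: m_def)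
  qed simp
  have hi: "(qint q n - qint q m) * (h (n - 1) * ?W (Suc k))
      = (qint q n - qint q m) * (g m * h (N - i) * ?P (Suc l) k)"
  proof (cases "m = n")
    case False
    then have "Suc k \<le> N" using mn step.prems by (auto simp: n_def m_def)
    with step.IH[of "Suc k"] step.prems show ?thesis
      unfolding n1(1) by (simp add: m_def P_indep[of _ "Suc k"])
  qed simp
  have W: "weighted_count N i q g l k = qint q m * ?W k + (qint q n - qint q m) * ?W (Suc k)"
    unfolding m_def n_def using step.hyps step.prems assms(1) by (intro weighted_count_split) auto
  have P: "?P l k = qint q n * ?P (Suc l) k"
    using weighted_count_split[of l i N k q "\<lambda>_. 1"] step.hyps step.prems assms(1) P_indep[of "Suc l" "Suc k"]
    by (simp add: n_def algebra_simps)
  \<comment> \<open>The additional factor \<open>h (n - 1)\<close> makes the induction hypotheses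
    applicable; it is nonzero by \<open>nz\<close> and is cancelled at the end.\<close>
  have "h (n - 1) * (h n * weighted_count N i q g l k)
      = h n * (qint q m * (h (n - 1) * ?W k) + (qint q n - qint q m) * (h (n - 1) * ?W (Suc k)))"
    by (simp add: W algebra_simps)
  also have "\<dots> = (h n * (qint q m * g (m - 1) + (qint q n - qint q m) * g m)) * h (N - i) * ?P (Suc l) k"
    unfolding lo hi by (simp add: algebra_simps)
  also have "\<dots> = h (n - 1) * (g m * h (N - i) * ?P l k)"
    unfolding rec[OF mn] P by (simp add: algebra_simps)
  finally show ?case
    using nz[OF n1(2)] by (simp add: m_def n_def)
qed

text \<open>Multiplication by \<open>r ^ m\<close> reverses the order of the powers in the geometric
  sum. This relates the transition weights, which involve \<open>q\<close>, to the martingales,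
  which involve \<open>r\<close>.\<close>

lemma qint_inverse:
  assumes "q * r = 1"
  shows "qint q (Suc m) * r ^ m = qint r (Suc m)"
proof (induction m)
  case (Suc m)
  have "qint q (Suc (Suc m)) * r ^ Suc m = r ^ Suc m + (q * r) * (qint q (Suc m) * r ^ m)"
    by (simp add: qint_Suc[of _ "Suc m"] algebra_simps)
  also have "\<dots> = qint r (Suc (Suc m))"
    unfolding Suc assms by (simp add: qint_def)
  finally show ?case .
qed (simp add: qint_def)

text \<open>For \<open>m > 0\<close> the last increment of \<open>qint r\<close> is
  \<open>r ^ (m - 1)\<close>, so \<open>qint_inverse\<close> yields
  \<open>qint q m * (qint r m - qint r (m - 1)) = qint r m\<close>. Used for \<open>m\<close> and
  for \<open>n\<close>, this turns both sides into
  \<open>qint r n * qint r m * (qint q n - 1)\<close>.\<close>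

lemma qint_martingale:
  assumes "q * r = 1"
  shows "qint r n * (qint q m * qint r (m - 1) + (qint q n - qint q m) * qint r m)
       = qint q n * qint r m * qint r (n - 1)"
proof (cases "m = 0 \<or> n = 0")
  case False
  then obtain m' n' where mn: "m = Suc m'" "n = Suc n'" by (metis not0_implies_Suc)
  define a b where "a = qint r m'" and "b = qint r n'"
  \<comment> \<open>This is \<open>qint_inverse\<close> with the powers of \<open>r\<close> written
    through \<open>a\<close> and \<open>b\<close>; what remains is a polynomial identity.\<close>
  have "qint q m * (1 + (r - 1) * a) = 1 + r * a" "qint q n * (1 + (r - 1) * b) = 1 + r * b"
    using qint_inverse[OF assms, of m'] qint_inverse[OF assms, of n']
    by (simp_all add: mn a_def b_def power_eq_qint qint_Suc[of r])
  then have "(1 + r * b) * (qint q m * a + (qint q n - qint q m) * (1 + r * a))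
       = qint q n * (1 + r * a) * b" by algebra
  then show ?thesis by (simp add: mn a_def b_def qint_Suc[of r])
qed auto

text \<open>Here \<open>g m = r * qint r m * qint r (m - 1)\<close> for \<open>m > 0\<close>, and
  the increments satisfy \<open>qint q m * (g m - g (m - 1)) = (1 + q) * g m\<close>. The argument
  for \<open>qint r\<close> applies with \<open>1 + q\<close> in place of 1: both sides equal
  \<open>g n * g m * (qint q n - 1 - q)\<close>.\<close>

lemma qint_martingale_second:
  fixes r :: real
  assumes "q * r = 1"
  defines "g \<equiv> \<lambda>m. qint r m * (qint r m - 1)"
  shows "g n * (qint q m * g (m - 1) + (qint q n - qint q m) * g m)
       = qint q n * g m * g (n - 1)"
proof (cases "m = 0 \<or> n = 0")
  case False
  then obtain m' n' where mn: "m = Suc m'" "n = Suc n'" by (metis not0_implies_Suc)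
  define a b where "a = qint r m'" and "b = qint r n'"
  have "qint q m * (1 + (r - 1) * a) = 1 + r * a" "qint q n * (1 + (r - 1) * b) = 1 + r * b"
    using qint_inverse[OF assms(1), of m'] qint_inverse[OF assms(1), of n']
    by (simp_all add: mn a_def b_def power_eq_qint qint_Suc[of r])
  then have "((1 + r * b) * (r * b)) * (qint q m * (a * (a - 1)) + (qint q n - qint q m) * ((1 + r * a) * (r * a)))
       = qint q n * ((1 + r * a) * (r * a)) * (b * (b - 1))" by algebra
  then show ?thesis by (simp add: mn g_def a_def b_def qint_Suc[of r])
qed (auto simp: g_def)

section \<open>Moments of the number of particles beyond a site\<close>

definition mallows_expectation :: "nat \<Rightarrow> real \<Rightarrow> ((nat \<Rightarrow> nat) \<Rightarrow> real) \<Rightarrow> real" where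
  "mallows_expectation N q X =
     (\<Sum>\<pi> | \<pi> permutes {1..N}. q ^ inversions N \<pi> * X \<pi>) / mallows_norm N q"

lemma mallows_norm_pos: "q > 0 \<Longrightarrow> mallows_norm N q > 0"
  unfolding mallows_norm_def
  by (rule sum_pos) (auto simp: finite_permutations intro: permutes_id)

definition particles_after :: "nat \<Rightarrow> nat \<Rightarrow> nat \<Rightarrow> (nat \<Rightarrow> nat) \<Rightarrow> nat" where
  "particles_after N k i \<pi> = card {j \<in> {Suc i..N}. \<pi> j \<le> k}"

lemma mallows_expectation_particles_after:
  "mallows_expectation N q (\<lambda>\<pi>. g (particles_after N k i \<pi>))
     = weighted_count N i q g 1 k / mallows_norm N q"
  by (simp add: mallows_expectation_def weighted_count_def particles_after_def inversions_eq)

text \<open>The martingale \<open>g m / h n\<close> starts at \<open>k\<close> particles on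
  \<open>N\<close> sites and is evaluated when \<open>N - i\<close> sites are left, where
  \<open>h\<close> is deterministic. The case of constant \<open>g\<close> supplies the
  normalisation.\<close>

lemma mallows_expectation_transport:
  assumes "q > 0" "i \<le> N" "k \<le> N"
    and "\<And>m n. m \<le> n \<Longrightarrow> h n * (qint q m * g (m - 1) + (qint q n - qint q m) * g m)
                 = qint q n * g m * h (n - 1)"
    and nz: "\<And>n. n \<ge> N - i \<Longrightarrow> h n \<noteq> 0"
  shows "mallows_expectation N q (\<lambda>\<pi>. g (particles_after N k i \<pi>)) = g k * h (N - i) / h N"
proof -
  have "h N * weighted_count N i q g 1 k = g k * h (N - i) * weighted_count N i q (\<lambda>_. 1) 1 k"
    using weighted_count_eq[of i N 1 k h q g] assms by simp
  moreover have "weighted_count N i q (\<lambda>_. 1) 1 k = mallows_norm N q"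
    by (simp add: weighted_count_def mallows_norm_def inversions_eq)
  ultimately show ?thesis
    using nz[of N] mallows_norm_pos[OF assms(1), of N]
    unfolding mallows_expectation_particles_after by (simp add: field_simps)
qed

lemma expectation_qint:
  assumes "q > 0" "i < N" "k \<le> N"
  shows "mallows_expectation N q (\<lambda>\<pi>. qint (1 / q) (particles_after N k i \<pi>))
       = qint (1 / q) k * qint (1 / q) (N - i) / qint (1 / q) N"
proof (rule mallows_expectation_transport)
  show "qint (1 / q) n \<noteq> 0" if "n \<ge> N - i" for n
    using qint_pos[of "1 / q" n] that assms by force
next
  show "qint (1 / q) n * (qint q m * qint (1 / q) (m - 1) + (qint q n - qint q m) * qint (1 / q) m)
      = qint q n * qint (1 / q) m * qint (1 / q) (n - 1)" for m n
    by (rule qint_martingale) (use assms in simp)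
qed (use assms in auto)

text \<open>The function \<open>g\<close> vanishes at 0 and 1, so at least two sites must remain for
  the denominators to be nonzero.\<close>

lemma expectation_qint_second:
  fixes q :: real
  assumes "q > 0" "i + 2 \<le> N" "k \<le> N"
  defines "g \<equiv> \<lambda>m. qint (1 / q) m * (qint (1 / q) m - 1)"
  shows "mallows_expectation N q (\<lambda>\<pi>. g (particles_after N k i \<pi>)) = g k * g (N - i) / g N"
proof (rule mallows_expectation_transport)
  show "g n \<noteq> 0" if n: "n \<ge> N - i" for n
  proof -
    obtain n' where "n = Suc n'" "n' > 0"
      using n assms by (cases n) auto
    then show ?thesis
      using qint_pos[of "1 / q" n'] qint_pos[of "1 / q" n] assms
      by (simp add: g_def qint_Suc)
  qed
next
  fix m n :: nat
  show "g n * (qint q m * g (m - 1) + (qint q n - qint q m) * g m) = qint q n * g m * g (n - 1)"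
    unfolding g_def by (rule qint_martingale_second) (use assms in simp)
qed (use assms in auto)

section \<open>Expectations under the Mallows measure\<close>

lemma mallows_expectation_add:
  "mallows_expectation N q (\<lambda>\<pi>. X \<pi> + Y \<pi>) = mallows_expectation N q X + mallows_expectation N q Y"
  by (simp add: mallows_expectation_def distrib_left sum.distrib add_divide_distrib)

lemma mallows_expectation_cmult:
  "mallows_expectation N q (\<lambda>\<pi>. c * X \<pi>) = c * mallows_expectation N q X"
  by (simp add: mallows_expectation_def sum_distrib_left mult.left_commute)

lemma mallows_expectation_const: "q > 0 \<Longrightarrow> mallows_expectation N q (\<lambda>_. c) = c"
  using mallows_norm_pos[of q N]
  by (simp add: mallows_expectation_def mallows_norm_def flip: sum_distrib_right)

lemma mallows_expectation_sum:
  "mallows_expectation N q (\<lambda>\<pi>. \<Sum>b\<in>B. X b \<pi>) = (\<Sum>b\<in>B. mallows_expectation N q (X b))"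
  by (simp add: mallows_expectation_def sum_distrib_left flip: sum_divide_distrib sum.swap[of _ B])

lemma mallows_expectation_mono:
  assumes "q > 0" "\<And>\<pi>. \<pi> permutes {1..N} \<Longrightarrow> X \<pi> \<le> Y \<pi>"
  shows "mallows_expectation N q X \<le> mallows_expectation N q Y"
  unfolding mallows_expectation_def
  using assms mallows_norm_pos[OF assms(1), of N]
  by (intro divide_right_mono sum_mono mult_left_mono) auto

lemma mallows_expectation_nonneg:
  assumes "q > 0" "\<And>\<pi>. \<pi> permutes {1..N} \<Longrightarrow> 0 \<le> X \<pi>"
  shows "0 \<le> mallows_expectation N q X"
  using mallows_expectation_mono[of q N "\<lambda>_. 0" X] assms by (simp add: mallows_expectation_const)

lemma mallows_expectation_square_diff:
  assumes "q > 0"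
  shows "mallows_expectation N q (\<lambda>\<pi>. (X \<pi> - c)\<^sup>2)
     = mallows_expectation N q (\<lambda>\<pi>. (X \<pi>)\<^sup>2) - 2 * c * mallows_expectation N q X + c\<^sup>2"
proof -
  have "(X \<pi> - c)\<^sup>2 = (X \<pi>)\<^sup>2 + ((- 2 * c) * X \<pi> + c\<^sup>2)" for \<pi>
    by (simp add: power2_eq_square algebra_simps)
  then show ?thesis
    by (simp only: mallows_expectation_add mallows_expectation_cmult mallows_expectation_const[OF assms])
qed

text \<open>This is the nonnegativity of the variance of \<open>\<bar>X\<bar>\<close>.\<close>

lemma mallows_expectation_abs_le:
  assumes "q > 0"
  shows "mallows_expectation N q (\<lambda>\<pi>. \<bar>X \<pi>\<bar>) \<le> sqrt (mallows_expectation N q (\<lambda>\<pi>. (X \<pi>)\<^sup>2))"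
proof (rule real_le_rsqrt)
  let ?\<mu> = "mallows_expectation N q (\<lambda>\<pi>. \<bar>X \<pi>\<bar>)"
  have "0 \<le> mallows_expectation N q (\<lambda>\<pi>. (\<bar>X \<pi>\<bar> - ?\<mu>)\<^sup>2)"
    by (rule mallows_expectation_nonneg[OF assms]) simp
  then show "?\<mu>\<^sup>2 \<le> mallows_expectation N q (\<lambda>\<pi>. (X \<pi>)\<^sup>2)"
    unfolding mallows_expectation_square_diff[OF assms] by (simp add: power2_eq_square)
qed

text \<open>The bridge from finite weighted sums to the measure \<open>mallows N q\<close>; all
  limits before it concern \<open>mallows_expectation\<close> only.\<close>

lemma mallows_markov:
  assumes "q > 0" "\<epsilon> > 0"
  shows "measure (mallows N q) {\<pi> \<in> space (mallows N q). \<bar>X \<pi>\<bar> > \<epsilon>}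
       \<le> mallows_expectation N q (\<lambda>\<pi>. \<bar>X \<pi>\<bar>) / \<epsilon>"
proof -
  let ?S = "{\<pi>. \<pi> permutes {1..N}}"
  have fin: "finite ?S" by (simp add: finite_permutations)
  let ?p = "\<lambda>\<pi>. q ^ inversions N \<pi> / mallows_norm N q"
  have p: "?p \<pi> \<ge> 0" for \<pi> using assms mallows_norm_pos[of q N] by simp
  have "measure (mallows N q) {\<pi> \<in> space (mallows N q). \<bar>X \<pi>\<bar> > \<epsilon>}
      = (\<Sum>\<pi> | \<pi> \<in> ?S \<and> \<bar>X \<pi>\<bar> > \<epsilon>. ?p \<pi>)"
    unfolding mallows_def space_point_measure
    by (subst measure_point_measure_finite_if) (use fin p in auto)
  also have "\<dots> \<le> (\<Sum>\<pi> | \<pi> \<in> ?S \<and> \<bar>X \<pi>\<bar> > \<epsilon>. ?p \<pi> * \<bar>X \<pi>\<bar> / \<epsilon>)"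
  proof (rule sum_mono)
    fix \<pi> assume "\<pi> \<in> {\<pi> \<in> ?S. \<bar>X \<pi>\<bar> > \<epsilon>}"
    then have "1 \<le> \<bar>X \<pi>\<bar> / \<epsilon>" using assms by simp
    from mult_left_mono[OF this p] show "?p \<pi> \<le> ?p \<pi> * \<bar>X \<pi>\<bar> / \<epsilon>" by simp
  qed
  also have "\<dots> \<le> (\<Sum>\<pi>\<in>?S. ?p \<pi> * \<bar>X \<pi>\<bar> / \<epsilon>)"
  proof (rule sum_mono2)
    show "0 \<le> ?p \<pi> * \<bar>X \<pi>\<bar> / \<epsilon>" for \<pi>
      by (intro divide_nonneg_pos[OF mult_nonneg_nonneg[OF p]]) (use assms in auto)
  qed (use fin in auto)
  also have "\<dots> = mallows_expectation N q (\<lambda>\<pi>. \<bar>X \<pi>\<bar>) / \<epsilon>"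
    by (simp add: mallows_expectation_def sum_divide_distrib)
  finally show ?thesis .
qed

section \<open>The scaling limit\<close>

lemma nat_floor_limit:
  assumes "0 \<le> y"
  shows "(\<lambda>N. real (nat \<lfloor>y * real N\<rfloor>) / real N) \<longlonglongrightarrow> y"
proof -
  have "(\<lambda>N. real (nat \<lfloor>y * real N\<rfloor>) / real N - y) \<longlonglongrightarrow> 0"
  proof (rule tendsto_0_le[where K = 1])
    show "(\<lambda>N. 1 / real N) \<longlonglongrightarrow> 0" by real_asymp
    show "\<forall>\<^sub>F N in sequentially. norm (real (nat \<lfloor>y * real N\<rfloor>) / real N - y) \<le> norm (1 / real N) * 1"
      using eventually_gt_at_top[of 0]
    proof eventually_elim
      case (elim N)
      have "\<bar>real (nat \<lfloor>y * real N\<rfloor>) - y * real N\<bar> \<le> 1"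
        using assms by (simp add: of_nat_nat) linarith
      moreover have "real (nat \<lfloor>y * real N\<rfloor>) / real N - y = (real (nat \<lfloor>y * real N\<rfloor>) - y * real N) / real N"
        using elim by (simp add: field_simps)
      ultimately show ?case by (simp add: divide_right_mono)
    qed
  qed
  then show ?thesis by (simp add: LIM_zero_iff)
qed

text \<open>For \<open>\<beta> > 0\<close> the weight is not positive for small \<open>N\<close>, so
  the estimates below are claimed only eventually.\<close>

lemma eventually_weight_pos: "\<forall>\<^sub>F N in sequentially. 1 - \<beta> / real N > 0"
proof -
  have "(\<lambda>N. 1 - \<beta> / real N) \<longlonglongrightarrow> 1 - 0"
    by (intro tendsto_intros lim_const_over_n)
  then show ?thesis by (rule order_tendstoD) simp
qed

section \<open>Scaling limits of powers and q-integers\<close>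

abbreviation recip_weight :: "real \<Rightarrow> nat \<Rightarrow> real" where
  "recip_weight \<beta> N \<equiv> 1 / (1 - \<beta> / real N)"

lemma recip_weight_power_limit:
  assumes "(\<lambda>N. real (n N) / real N) \<longlonglongrightarrow> t"
  shows "(\<lambda>N. recip_weight \<beta> N ^ n N) \<longlonglongrightarrow> exp (\<beta> * t)"
proof -
  have "(\<lambda>N. - (real N * ln (1 - \<beta> / real N))) \<longlonglongrightarrow> \<beta>"
    by real_asymp
  then have "(\<lambda>N. exp (real (n N) / real N * - (real N * ln (1 - \<beta> / real N)))) \<longlonglongrightarrow> exp (t * \<beta>)"
    by (intro tendsto_intros assms)
  moreover have "\<forall>\<^sub>F N in sequentially.
      exp (real (n N) / real N * - (real N * ln (1 - \<beta> / real N))) = recip_weight \<beta> N ^ n N"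
    using eventually_weight_pos[of \<beta>] eventually_gt_at_top[of 0]
  proof eventually_elim
    case (elim N)
    then have "exp (real (n N) * - ln (1 - \<beta> / real N)) = exp (- ln (1 - \<beta> / real N)) ^ n N"
      by (intro exp_of_nat_mult)
    with elim show ?case by (simp add: exp_minus inverse_eq_divide)
  qed
  ultimately show ?thesis
    by (simp add: mult.commute Lim_transform_eventually)
qed

text \<open>For \<open>t \<ge> 0\<close> this is the integral of \<open>exp (\<beta> * s)\<close>
  over \<open>s\<close> from 0 to \<open>t\<close>, approximated by the Riemann sum
  \<open>qint r m / N\<close> with \<open>m\<close> close to \<open>t * N\<close>.\<close>

definition qint_limit :: "real \<Rightarrow> real \<Rightarrow> real" where
  "qint_limit \<beta> t = (if \<beta> = 0 then t else (exp (\<beta> * t) - 1) / \<beta>)"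

lemma qint_scaling_limit:
  assumes "(\<lambda>N. real (n N) / real N) \<longlonglongrightarrow> t"
  shows "(\<lambda>N. qint (recip_weight \<beta> N) (n N) / real N) \<longlonglongrightarrow> qint_limit \<beta> t"
proof (cases "\<beta> = 0")
  case True
  with assms show ?thesis by (simp add: qint_def qint_limit_def)
next
  case False
  \<comment> \<open>The geometric sum is \<open>(r ^ n - 1) / (r - 1)\<close>, and
    \<open>(r - 1) * (1 - \<beta> / N) = \<beta> / N\<close> cancels the scale
    \<open>N\<close>.\<close>
  have "(\<lambda>N. (recip_weight \<beta> N ^ n N - 1) * (1 - \<beta> / real N) / \<beta>)
      \<longlonglongrightarrow> (exp (\<beta> * t) - 1) * (1 - 0) / \<beta>"
    by (intro tendsto_intros recip_weight_power_limit assms lim_const_over_n False)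
  moreover have "\<forall>\<^sub>F N in sequentially.
      (recip_weight \<beta> N ^ n N - 1) * (1 - \<beta> / real N) / \<beta> = qint (recip_weight \<beta> N) (n N) / real N"
    using eventually_weight_pos[of \<beta>] eventually_gt_at_top[of 0]
  proof eventually_elim
    case (elim N)
    have "(recip_weight \<beta> N - 1) * (1 - \<beta> / real N) = \<beta> / real N"
      using elim by (simp add: left_diff_distrib)
    moreover have "(recip_weight \<beta> N ^ n N - 1) * (1 - \<beta> / real N) / \<beta>
        = (recip_weight \<beta> N - 1) * (1 - \<beta> / real N) * qint (recip_weight \<beta> N) (n N) / \<beta>"
      unfolding power_eq_qint[of "recip_weight \<beta> N"] by (simp only: mult_ac add_diff_cancel_left')
    ultimately show ?case using False by simp
  qed
  ultimately show ?thesis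
    using False by (simp add: qint_limit_def Lim_transform_eventually)
qed

lemma qint_limit_pos: "t > 0 \<Longrightarrow> qint_limit \<beta> t > 0"
  by (cases "\<beta> > 0") (auto simp: qint_limit_def divide_neg_neg mult_neg_pos not_less)

text \<open>The powers \<open>r ^ j\<close> with \<open>j < N\<close> are monotone in
  \<open>j\<close>, hence all at least the smaller of 1 and \<open>r ^ N\<close>. The resulting
  lower Lipschitz bound transfers concentration from \<open>[m]\<close> to \<open>m\<close>.\<close>

lemma qint_diff_ge:
  assumes "r > 0" "a \<le> b" "b \<le> N"
  shows "min 1 (r ^ N) * real (b - a) \<le> qint r b - qint r a"
proof -
  have "min 1 (r ^ N) \<le> r ^ j" if "j \<in> {a..<b}" for j
  proof (cases "r \<ge> 1")
    case False
    then have "r ^ N \<le> r ^ j" using that assms by (intro power_decreasing) auto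
    then show ?thesis by simp
  qed (simp add: min.coboundedI1)
  then have "(\<Sum>j\<in>{a..<b}. min 1 (r ^ N)) \<le> (\<Sum>j\<in>{a..<b}. r ^ j)"
    by (rule sum_mono)
  also have "\<dots> = qint r b - qint r a"
    unfolding qint_def lessThan_atLeast0 using assms(2) by (simp add: sum_diff_nat_ivl)
  finally show ?thesis by (simp add: mult.commute)
qed

lemma qint_abs_diff_ge:
  assumes "r > 0" "a \<le> N" "b \<le> N"
  shows "min 1 (r ^ N) * \<bar>real a - real b\<bar> \<le> \<bar>qint r a - qint r b\<bar>"
proof (cases "a \<le> b")
  case True
  with qint_diff_ge[OF assms(1) True assms(3)] show ?thesis by (simp add: of_nat_diff)
next
  case False
  then have "b \<le> a" by simp
  with qint_diff_ge[OF assms(1) this assms(2)] show ?thesis by (simp add: of_nat_diff)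
qed

text \<open>
  The limit of \<open>m/N\<close> at the site \<open>xN\<close>: the solution \<open>s\<close> of
  \<open>qint_limit \<beta> s = qint_limit \<beta> y * qint_limit \<beta> (1 - x) / qint_limit \<beta> 1\<close>.
\<close>

definition remaining :: "real \<Rightarrow> real \<Rightarrow> real \<Rightarrow> real" where
  "remaining \<beta> y x = (if \<beta> = 0 then y * (1 - x)
     else ln (1 + (exp (\<beta> * (1 - x)) - 1) * (exp (\<beta> * y) - 1) / (exp \<beta> - 1)) / \<beta>)"

text \<open>The factor \<open>exp (\<beta> * (1 - x)) - 1\<close> lies between 0 and
  \<open>exp \<beta> - 1\<close>, and the other factor divided by \<open>exp \<beta> - 1\<close>
  lies in \<open>{0..1}\<close>. So \<open>W\<close> lies between 1 and \<open>exp \<beta>\<close>,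
  in the order given by the sign of \<open>\<beta>\<close>, and dividing \<open>ln W\<close> by
  \<open>\<beta>\<close> removes the sign.\<close>

lemma remaining_arg_bounds:
  fixes \<beta> x y :: real
  assumes "\<beta> \<noteq> 0" "x \<in> {0..1}" "y \<in> {0..1}"
  defines "W \<equiv> 1 + (exp (\<beta> * (1 - x)) - 1) * (exp (\<beta> * y) - 1) / (exp \<beta> - 1)"
  shows "W > 0" "ln W / \<beta> \<in> {0..1}"
proof -
  define a b e where "a = exp (\<beta> * (1 - x)) - 1" and "b = exp (\<beta> * y) - 1" and "e = exp \<beta> - 1"
  have W: "W = 1 + a * (b / e)" by (simp add: W_def a_def b_def e_def)
  show "W > 0" "ln W / \<beta> \<in> {0..1}"
  proof (atomize (full), cases "\<beta> > 0")
    case True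
    then have le: "0 \<le> a" "a \<le> e" "0 \<le> b" "b \<le> e" "0 < e"
      using assms by (auto simp: a_def b_def e_def mult_le_cancel_left1 mult_left_le)
    then have "0 \<le> b / e" "b / e \<le> 1" by auto
    then have "0 \<le> a * (b / e)" "a * (b / e) \<le> e"
      using le mult_left_le[of "b / e" a] by auto
    then have "1 \<le> W" "W \<le> exp \<beta>" by (auto simp: W e_def)
    then have "0 \<le> ln W" by simp
    have "ln W \<le> ln (exp \<beta>)" by (rule ln_mono) (use \<open>1 \<le> W\<close> \<open>W \<le> exp \<beta>\<close> in auto)
    with \<open>1 \<le> W\<close> \<open>0 \<le> ln W\<close> True show "W > 0 \<and> ln W / \<beta> \<in> {0..1}" by simp
  next
    case False
    then have neg: "\<beta> < 0" using assms by simp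
    then have le: "a \<le> 0" "e \<le> a" "b \<le> 0" "e \<le> b" "e < 0"
      using assms by (auto simp: a_def b_def e_def mult_le_cancel_left1 mult_le_0_iff mult_le_cancel_left2)
    then have "0 \<le> b / e" "b / e \<le> 1" by (auto simp: divide_le_eq zero_le_divide_iff)
    then have "a * (b / e) \<le> 0" "a * (b / e) \<ge> e"
      using le mult_left_le[of "b / e" "- a"] mult_nonpos_nonneg[of a "b / e"] by auto
    then have bd: "W \<le> 1" "exp \<beta> \<le> W" by (auto simp: W e_def)
    then have pos: "W > 0" using exp_gt_zero[of \<beta>] by linarith
    with bd have "ln W \<le> 0" "\<beta> \<le> ln W" by (auto simp: ln_ge_iff)
    with pos neg show "W > 0 \<and> ln W / \<beta> \<in> {0..1}" by (auto simp: zero_le_divide_iff divide_le_eq)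
  qed
qed

lemma remaining_bounds:
  assumes "x \<in> {0..1}" "y \<in> {0..1}"
  shows "remaining \<beta> y x \<in> {0..1}"
proof (cases "\<beta> = 0")
  case True
  with assms show ?thesis by (auto simp: remaining_def intro: mult_le_one)
next
  case False
  with remaining_arg_bounds(2)[OF False assms] show ?thesis by (simp add: remaining_def)
qed

lemma qint_limit_remaining:
  assumes "x \<in> {0..1}" "y \<in> {0..1}"
  shows "qint_limit \<beta> (remaining \<beta> y x) = qint_limit \<beta> y * qint_limit \<beta> (1 - x) / qint_limit \<beta> 1"
proof (cases "\<beta> = 0")
  case True
  then show ?thesis by (simp add: remaining_def qint_limit_def)
next
  case False
  with remaining_arg_bounds(1)[OF False assms] show ?thesis
    by (simp add: remaining_def qint_limit_def field_simps)
qed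

lemma remaining_1: "remaining \<beta> y 1 = 0"
  by (simp add: remaining_def)

section \<open>Concentration of the number of remaining particles\<close>

lemma nat_floor_le: "0 \<le> t \<Longrightarrow> t \<le> 1 \<Longrightarrow> nat \<lfloor>t * real N\<rfloor> \<le> N"
proof -
  assume t: "0 \<le> t" "t \<le> 1"
  have "\<lfloor>t * real N\<rfloor> \<le> int N"
    using t by (simp add: floor_le_iff) (smt (verit) mult_left_le_one_le of_nat_0_le_iff)
  then show ?thesis by simp
qed

lemma particles_after_le: "i \<le> N \<Longrightarrow> particles_after N k i \<pi> \<le> N"
proof -
  have "particles_after N k i \<pi> \<le> card {Suc i..N}"
    unfolding particles_after_def by (rule card_mono) auto
  then show ?thesis by simp
qed

text \<open>After scaling, the mean tends to \<open>A * B / C\<close> and the second moment to its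
  square: the linear part of \<open>[m]([m] - 1)\<close> is of order \<open>N\<close> and disappears
  against \<open>N\<^sup>2\<close>. Centring at a sequence \<open>d\<close>, not at its limit,
  allows a later comparison with the q-integer of an actual number of particles.\<close>

lemma qint_second_moment_limit:
  fixes \<beta> x y c :: real and d :: "nat \<Rightarrow> real"
  assumes x: "0 \<le> x" "x < 1" and y: "0 \<le> y" "y \<le> 1"
    and d: "d \<longlonglongrightarrow> qint_limit \<beta> y * qint_limit \<beta> (1 - x) / qint_limit \<beta> 1"
  defines "X \<equiv> \<lambda>N \<pi>. qint (recip_weight \<beta> N) (particles_after N (nat \<lfloor>y * real N\<rfloor>) (nat \<lfloor>x * real N\<rfloor>) \<pi>) / real N"
  shows "(\<lambda>N. mallows_expectation N (1 - \<beta> / real N) (\<lambda>\<pi>. (X N \<pi> - d N)\<^sup>2)) \<longlonglongrightarrow> 0"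
proof -
  define k i where "k = (\<lambda>N. nat \<lfloor>y * real N\<rfloor>)" and "i = (\<lambda>N. nat \<lfloor>x * real N\<rfloor>)"
  let ?r = "recip_weight \<beta>"
  define A B C where "A = qint_limit \<beta> y" and "B = qint_limit \<beta> (1 - x)" and "C = qint_limit \<beta> 1"
  have C: "C > 0" unfolding C_def by (rule qint_limit_pos) simp
  have i_le: "i N \<le> N" for N unfolding i_def using x by (intro nat_floor_le) auto
  have k_le: "k N \<le> N" for N unfolding k_def using y by (intro nat_floor_le) auto
  have n_lim: "(\<lambda>N. real (N - i N) / real N) \<longlonglongrightarrow> 1 - x"
  proof -
    have "(\<lambda>N. 1 - real (i N) / real N) \<longlonglongrightarrow> 1 - x"
      unfolding i_def by (intro tendsto_intros nat_floor_limit x)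
    moreover have "\<forall>\<^sub>F N in sequentially. 1 - real (i N) / real N = real (N - i N) / real N"
      using eventually_gt_at_top[of 0]
      by eventually_elim (simp add: of_nat_diff i_le diff_divide_distrib)
    ultimately show ?thesis by (rule Lim_transform_eventually)
  qed
  have N_lim: "(\<lambda>N. real N / real N) \<longlonglongrightarrow> 1"
    by (rule Lim_transform_eventually[OF tendsto_const])
       (use eventually_gt_at_top[of 0] in \<open>eventually_elim, simp\<close>)
  define a b e where "a = (\<lambda>N. qint (?r N) (k N) / real N)" and "b = (\<lambda>N. qint (?r N) (N - i N) / real N)"
    and "e = (\<lambda>N. qint (?r N) N / real N)"
  have "a \<longlonglongrightarrow> A"
    unfolding a_def A_def k_def by (intro qint_scaling_limit nat_floor_limit y)
  moreover have "b \<longlonglongrightarrow> B"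
    unfolding b_def B_def by (rule qint_scaling_limit[OF n_lim])
  moreover have "e \<longlonglongrightarrow> C"
    unfolding e_def C_def by (rule qint_scaling_limit[OF N_lim])
  ultimately have lims: "a \<longlonglongrightarrow> A" "b \<longlonglongrightarrow> B" "e \<longlonglongrightarrow> C" .
  \<comment> \<open>This uses \<open>x < 1\<close>: the number of remaining sites grows linearly, so
    the second moment formula eventually applies.\<close>
  have n_ge_2: "\<forall>\<^sub>F N in sequentially. i N + 2 \<le> N"
  proof -
    have "filterlim (\<lambda>N. real (N - i N) / real N * real N) at_top sequentially"
      using x by (intro filterlim_tendsto_pos_mult_at_top[OF n_lim] filterlim_real_sequentially) auto
    then have "\<forall>\<^sub>F N in sequentially. 2 \<le> real (N - i N) / real N * real N"
      by (simp add: filterlim_at_top)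
    then show ?thesis
      using eventually_gt_at_top[of 0]
    proof eventually_elim
      case (elim N)
      then have "2 \<le> real (N - i N)" by simp
      then show ?case by linarith
    qed
  qed
  have d': "d \<longlonglongrightarrow> A * B / C" using d by (simp only: A_def B_def C_def)
  define h :: "nat \<Rightarrow> real" where "h = (\<lambda>N. 1 / real N)"
  have h: "h \<longlonglongrightarrow> 0" unfolding h_def by (rule lim_const_over_n)
  \<comment> \<open>The first term comes from writing \<open>[m]\<^sup>2\<close> as
    \<open>[m]([m] - 1) + [m]\<close>, and \<open>h N\<close> is the scaled 1 in
    \<open>[m] - 1\<close>. The last two terms come from the centring at \<open>d N\<close>.\<close>
  have "(\<lambda>N. a N * b N / e N * h N
      + a N * (a N - h N) * (b N * (b N - h N)) / (e N * (e N - h N))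
      - 2 * d N * (a N * b N / e N) + (d N)\<^sup>2)
    \<longlonglongrightarrow> A * B / C * 0 + A * (A - 0) * (B * (B - 0)) / (C * (C - 0)) - 2 * (A * B / C) * (A * B / C) + (A * B / C)\<^sup>2"
    by (intro tendsto_add tendsto_diff tendsto_mult tendsto_divide tendsto_power tendsto_const lims d' h)
       (use C in simp_all)
  also have "A * B / C * 0 + A * (A - 0) * (B * (B - 0)) / (C * (C - 0)) - 2 * (A * B / C) * (A * B / C) + (A * B / C)\<^sup>2 = 0"
    by (simp add: power2_eq_square)
  finally show ?thesis
  proof (rule Lim_transform_eventually)
    show "\<forall>\<^sub>F N in sequentially. a N * b N / e N * h N
      + a N * (a N - h N) * (b N * (b N - h N)) / (e N * (e N - h N))
      - 2 * d N * (a N * b N / e N) + (d N)\<^sup>2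
      = mallows_expectation N (1 - \<beta> / real N) (\<lambda>\<pi>. (X N \<pi> - d N)\<^sup>2)"
      using n_ge_2 eventually_weight_pos[of \<beta>] eventually_gt_at_top[of 0]
    proof eventually_elim
      case (elim N)
      let ?q = "1 - \<beta> / real N" and ?E = "mallows_expectation N (1 - \<beta> / real N)"
      let ?Y = "\<lambda>\<pi>. qint (?r N) (particles_after N (k N) (i N) \<pi>)"
      have q: "?q > 0" and N: "real N > 0" using elim by auto
      have X: "X N \<pi> = 1 / real N * ?Y \<pi>" for \<pi> by (simp add: X_def k_def i_def)
      have X2: "(X N \<pi>)\<^sup>2 = (1 / (real N)\<^sup>2) * (?Y \<pi> * (?Y \<pi> - 1) + ?Y \<pi>)" for \<pi>
        by (simp add: X power2_eq_square algebra_simps)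
      have EY: "?E ?Y = qint (?r N) (k N) * qint (?r N) (N - i N) / qint (?r N) N"
        using elim k_le by (intro expectation_qint) auto
      have "X N = (\<lambda>\<pi>. 1 / real N * ?Y \<pi>)" using X by auto
      then have EX: "?E (X N) = a N * b N / e N"
        unfolding a_def b_def e_def using N by (simp only: mallows_expectation_cmult EY) simp
      have "?E (\<lambda>\<pi>. ?Y \<pi> * (?Y \<pi> - 1))
         = (qint (?r N) (k N) * (qint (?r N) (k N) - 1)) * (qint (?r N) (N - i N) * (qint (?r N) (N - i N) - 1))
            / (qint (?r N) N * (qint (?r N) N - 1))"
        using elim k_le by (intro expectation_qint_second) auto
      also have "\<dots> = (real N)\<^sup>2 * (a N * (a N - 1 / real N) * (b N * (b N - 1 / real N)) / (e N * (e N - 1 / real N)))"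
        unfolding a_def b_def e_def diff_divide_distrib[symmetric] using N by (simp add: power2_eq_square)
      finally have EY2: "?E (\<lambda>\<pi>. ?Y \<pi> * (?Y \<pi> - 1))
          = (real N)\<^sup>2 * (a N * (a N - 1 / real N) * (b N * (b N - 1 / real N)) / (e N * (e N - 1 / real N)))" .
      have "?E ?Y = real N * (a N * b N / e N)"
        unfolding EY a_def b_def e_def using N by simp
      then have EX2: "?E (\<lambda>\<pi>. (X N \<pi>)\<^sup>2) = a N * b N / e N * (1 / real N)
          + a N * (a N - 1 / real N) * (b N * (b N - 1 / real N)) / (e N * (e N - 1 / real N))"
        unfolding X2 mallows_expectation_cmult mallows_expectation_add EY2
        using N by (simp add: power2_eq_square add_divide_distrib)
      show ?case
        unfolding mallows_expectation_square_diff[OF q] EX EX2 h_def ..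
    qed
  qed
qed

lemma particles_after_limit:
  fixes \<beta> x y :: real
  assumes x: "0 \<le> x" "x < 1" and y: "0 \<le> y" "y \<le> 1"
  defines "M \<equiv> \<lambda>N. particles_after N (nat \<lfloor>y * real N\<rfloor>) (nat \<lfloor>x * real N\<rfloor>)"
  shows "(\<lambda>N. mallows_expectation N (1 - \<beta> / real N)
            (\<lambda>\<pi>. \<bar>real (M N \<pi>) / real N - remaining \<beta> y x\<bar>)) \<longlonglongrightarrow> 0"
proof -
  let ?E = "\<lambda>N. mallows_expectation N (1 - \<beta> / real N)" and ?r = "recip_weight \<beta>"
  define s where "s = remaining \<beta> y x"
  have s: "0 \<le> s" "s \<le> 1" using remaining_bounds[of x y \<beta>] x y by (auto simp: s_def)
  \<comment> \<open>The lower bound for differences of q-integers compares natural numbers, so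
    \<open>s\<close> is replaced by a particle number close to \<open>s * N\<close>.\<close>
  define m where "m = (\<lambda>N. nat \<lfloor>s * real N\<rfloor>)"
  have m_lim: "(\<lambda>N. real (m N) / real N) \<longlonglongrightarrow> s"
    unfolding m_def by (rule nat_floor_limit) (rule s)
  define V where "V = (\<lambda>N. ?E N (\<lambda>\<pi>. (qint (?r N) (M N \<pi>) / real N - qint (?r N) (m N) / real N)\<^sup>2))"
  have "(\<lambda>N. qint (?r N) (m N) / real N) \<longlonglongrightarrow> qint_limit \<beta> y * qint_limit \<beta> (1 - x) / qint_limit \<beta> 1"
    using qint_scaling_limit[OF m_lim, of \<beta>] qint_limit_remaining[of x y \<beta>] x y by (simp add: s_def)
  from qint_second_moment_limit[OF x y this] have V_lim: "V \<longlonglongrightarrow> 0"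
    unfolding V_def M_def .
  have N_lim: "(\<lambda>N. real N / real N) \<longlonglongrightarrow> 1"
    by (rule Lim_transform_eventually[OF tendsto_const])
       (use eventually_gt_at_top[of 0] in \<open>eventually_elim, simp\<close>)
  \<comment> \<open>This lower Lipschitz constant has the positive limit
    \<open>min 1 (exp \<beta>)\<close>, so dividing the vanishing second moment by its square does
    no harm.\<close>
  define w where "w = (\<lambda>N. min 1 (?r N ^ N))"
  have "w \<longlonglongrightarrow> min 1 (exp (\<beta> * 1))"
    unfolding w_def by (intro tendsto_min tendsto_const recip_weight_power_limit N_lim)
  then have "(\<lambda>N. sqrt (V N / (w N)\<^sup>2) + \<bar>real (m N) / real N - s\<bar>)
      \<longlonglongrightarrow> sqrt (0 / (min 1 (exp (\<beta> * 1)))\<^sup>2) + \<bar>s - s\<bar>"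
    by (intro tendsto_intros V_lim m_lim) (auto simp: min_def)
  then have bound_lim: "(\<lambda>N. sqrt (V N / (w N)\<^sup>2) + \<bar>real (m N) / real N - s\<bar>) \<longlonglongrightarrow> 0" by simp
  show ?thesis unfolding s_def[symmetric]
  proof (rule tendsto_sandwich[OF _ _ tendsto_const bound_lim])
    show "\<forall>\<^sub>F N in sequentially. 0 \<le> ?E N (\<lambda>\<pi>. \<bar>real (M N \<pi>) / real N - s\<bar>)"
      using eventually_weight_pos[of \<beta>]
      by eventually_elim (rule mallows_expectation_nonneg, auto)
    show "\<forall>\<^sub>F N in sequentially. ?E N (\<lambda>\<pi>. \<bar>real (M N \<pi>) / real N - s\<bar>)
        \<le> sqrt (V N / (w N)\<^sup>2) + \<bar>real (m N) / real N - s\<bar>"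
      using eventually_weight_pos[of \<beta>] eventually_gt_at_top[of 0]
    proof eventually_elim
      case (elim N)
      have r: "?r N > 0" and N: "real N > 0" using elim by auto
      then have w: "w N > 0" by (simp add: w_def)
      have M_le: "M N \<pi> \<le> N" for \<pi>
        unfolding M_def by (intro particles_after_le nat_floor_le) (use x in auto)
      have m_le: "m N \<le> N" unfolding m_def by (intro nat_floor_le s)
      have "?E N (\<lambda>\<pi>. \<bar>real (M N \<pi>) / real N - s\<bar>)
          \<le> ?E N (\<lambda>\<pi>. \<bar>real (M N \<pi>) / real N - real (m N) / real N\<bar> + \<bar>real (m N) / real N - s\<bar>)"
        by (rule mallows_expectation_mono[OF elim(1)]) linarith
      also have "\<dots> = ?E N (\<lambda>\<pi>. \<bar>real (M N \<pi>) / real N - real (m N) / real N\<bar>) + \<bar>real (m N) / real N - s\<bar>"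
        by (simp only: mallows_expectation_add mallows_expectation_const[OF elim(1)])
      also have "?E N (\<lambda>\<pi>. \<bar>real (M N \<pi>) / real N - real (m N) / real N\<bar>)
          \<le> sqrt (?E N (\<lambda>\<pi>. (real (M N \<pi>) / real N - real (m N) / real N)\<^sup>2))"
        by (rule mallows_expectation_abs_le[OF elim(1)])
      also have "?E N (\<lambda>\<pi>. (real (M N \<pi>) / real N - real (m N) / real N)\<^sup>2)
          \<le> ?E N (\<lambda>\<pi>. 1 / (w N)\<^sup>2 * (qint (?r N) (M N \<pi>) / real N - qint (?r N) (m N) / real N)\<^sup>2)"
      proof (rule mallows_expectation_mono[OF elim(1)])
        fix \<pi>
        have "w N * \<bar>real (M N \<pi>) - real (m N)\<bar> \<le> \<bar>qint (?r N) (M N \<pi>) - qint (?r N) (m N)\<bar>"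
          unfolding w_def by (rule qint_abs_diff_ge[OF r M_le m_le])
        then have "\<bar>real (M N \<pi>) - real (m N)\<bar> / real N \<le> \<bar>qint (?r N) (M N \<pi>) - qint (?r N) (m N)\<bar> / w N / real N"
          using w N by (intro divide_right_mono) (auto simp: field_simps)
        then have "\<bar>real (M N \<pi>) / real N - real (m N) / real N\<bar>
            \<le> \<bar>(qint (?r N) (M N \<pi>) / real N - qint (?r N) (m N) / real N) / w N\<bar>"
          using w N by (simp add: abs_divide diff_divide_distrib[symmetric] divide_divide_eq_left mult.commute)
        then have "(real (M N \<pi>) / real N - real (m N) / real N)\<^sup>2
            \<le> ((qint (?r N) (M N \<pi>) / real N - qint (?r N) (m N) / real N) / w N)\<^sup>2"
          by (simp only: abs_le_square_iff)
        then show "(real (M N \<pi>) / real N - real (m N) / real N)\<^sup>2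
            \<le> 1 / (w N)\<^sup>2 * (qint (?r N) (M N \<pi>) / real N - qint (?r N) (m N) / real N)\<^sup>2"
          by (simp add: power_divide)
      qed
      also have "\<dots> = V N / (w N)\<^sup>2"
        unfolding V_def mallows_expectation_cmult by simp
      finally show ?case by simp
    qed
  qed
qed

section \<open>Particle counts on initial segments\<close>

lemma sum_particle_config:
  assumes \<pi>: "\<pi> permutes {1..N}" and "i \<le> N" "k \<le> N"
  shows "(\<Sum>j=1..i. particle_config k \<pi> j) = real k - real (particles_after N k i \<pi>)"
proof -
  have card_eq: "(\<Sum>j\<in>A. particle_config k \<pi> j) = real (card {j \<in> A. \<pi> j \<le> k})" if "finite A" for A
    unfolding particle_config_def using that by (simp add: sum.If_cases Int_def)
  have "\<pi> ` {j \<in> {1..N}. \<pi> j \<le> k} = {v \<in> \<pi> ` {1..N}. v \<le> k}" by auto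
  also have "\<dots> = {1..k}" unfolding permutes_image[OF \<pi>] using assms by auto
  finally have "card {1..k} = card {j \<in> {1..N}. \<pi> j \<le> k}"
    by (metis card_image permutes_inj_on[OF \<pi>])
  then have "(\<Sum>j=1..N. particle_config k \<pi> j) = real k" by (simp add: card_eq)
  moreover have "(\<Sum>j=1..N. particle_config k \<pi> j)
      = (\<Sum>j=1..i. particle_config k \<pi> j) + (\<Sum>j=Suc i..N. particle_config k \<pi> j)"
    using \<open>i \<le> N\<close> by (subst sum.union_disjoint[symmetric]) (auto intro!: sum.cong)
  ultimately show ?thesis by (simp add: card_eq particles_after_def)
qed

definition occupation :: "nat \<Rightarrow> nat \<Rightarrow> (nat \<Rightarrow> nat) \<Rightarrow> real \<Rightarrow> real" where
  "occupation N k \<pi> x = (\<Sum>j=1..nat \<lfloor>x * real N\<rfloor>. particle_config k \<pi> j) / real N"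

lemma occupation_limit:
  fixes \<beta> x y :: real
  assumes x: "x \<in> {0..1}" and y: "0 \<le> y" "y \<le> 1"
  shows "(\<lambda>N. mallows_expectation N (1 - \<beta> / real N)
            (\<lambda>\<pi>. \<bar>occupation N (nat \<lfloor>y * real N\<rfloor>) \<pi> x - (y - remaining \<beta> y x)\<bar>)) \<longlonglongrightarrow> 0"
proof -
  let ?E = "\<lambda>N. mallows_expectation N (1 - \<beta> / real N)"
  let ?k = "\<lambda>N. nat \<lfloor>y * real N\<rfloor>" and ?i = "\<lambda>N. nat \<lfloor>x * real N\<rfloor>"
  let ?M = "\<lambda>N. particles_after N (?k N) (?i N)"
  have M: "(\<lambda>N. ?E N (\<lambda>\<pi>. \<bar>real (?M N \<pi>) / real N - remaining \<beta> y x\<bar>)) \<longlonglongrightarrow> 0"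
  proof (cases "x = 1")
    \<comment> \<open>At the right end no site remains, where the moment formulas break down; both
      the count and its limit are 0.\<close>
    case True
    then show ?thesis
      by (simp add: remaining_1 particles_after_def mallows_expectation_def)
  next
    case False
    with x y show ?thesis by (intro particles_after_limit) auto
  qed
  have "(\<lambda>N. \<bar>real (?k N) / real N - y\<bar> + ?E N (\<lambda>\<pi>. \<bar>real (?M N \<pi>) / real N - remaining \<beta> y x\<bar>)) \<longlonglongrightarrow> \<bar>y - y\<bar> + 0"
    by (intro tendsto_intros M nat_floor_limit y)
  then have lim: "(\<lambda>N. \<bar>real (?k N) / real N - y\<bar> + ?E N (\<lambda>\<pi>. \<bar>real (?M N \<pi>) / real N - remaining \<beta> y x\<bar>)) \<longlonglongrightarrow> 0"
    by simp
  show ?thesis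
  proof (rule tendsto_sandwich[OF _ _ tendsto_const lim])
    show "\<forall>\<^sub>F N in sequentially. 0 \<le> ?E N (\<lambda>\<pi>. \<bar>occupation N (?k N) \<pi> x - (y - remaining \<beta> y x)\<bar>)"
      using eventually_weight_pos[of \<beta>]
      by eventually_elim (rule mallows_expectation_nonneg, auto)
    show "\<forall>\<^sub>F N in sequentially. ?E N (\<lambda>\<pi>. \<bar>occupation N (?k N) \<pi> x - (y - remaining \<beta> y x)\<bar>)
        \<le> \<bar>real (?k N) / real N - y\<bar> + ?E N (\<lambda>\<pi>. \<bar>real (?M N \<pi>) / real N - remaining \<beta> y x\<bar>)"
      using eventually_weight_pos[of \<beta>]
    proof eventually_elim
      case (elim N)
      have "?E N (\<lambda>\<pi>. \<bar>occupation N (?k N) \<pi> x - (y - remaining \<beta> y x)\<bar>)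
          \<le> ?E N (\<lambda>\<pi>. \<bar>real (?k N) / real N - y\<bar> + \<bar>real (?M N \<pi>) / real N - remaining \<beta> y x\<bar>)"
      proof (rule mallows_expectation_mono[OF elim])
        fix \<pi> assume "\<pi> permutes {1..N}"
        then have "(\<Sum>j=1..?i N. particle_config (?k N) \<pi> j) = real (?k N) - real (?M N \<pi>)"
          by (rule sum_particle_config) (use x y in \<open>auto intro!: nat_floor_le\<close>)
        then have "occupation N (?k N) \<pi> x = real (?k N) / real N - real (?M N \<pi>) / real N"
          unfolding occupation_def by (simp only: diff_divide_distrib)
        then show "\<bar>occupation N (?k N) \<pi> x - (y - remaining \<beta> y x)\<bar>
           \<le> \<bar>real (?k N) / real N - y\<bar> + \<bar>real (?M N \<pi>) / real N - remaining \<beta> y x\<bar>"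
          by linarith
      qed
      then show ?case
        by (simp only: mallows_expectation_add mallows_expectation_const[OF elim])
    qed
  qed
qed

section \<open>The limiting density\<close>

definition rho_denom :: "real \<Rightarrow> real \<Rightarrow> real \<Rightarrow> real" where
  "rho_denom \<beta> x y = exp (\<beta> / 4) * cosh (\<beta> * (x - y) / 2) - exp (- \<beta> / 4) * cosh (\<beta> * (x + y - 1) / 2)"

text \<open>Extracting this positive factor leaves the denominator of the exponential form of
  \<open>\<rho>\<close>. It settles at once that the hyperbolic denominator does not vanish and,
  together with \<open>rho_numerator_eq\<close>, that the two closed forms agree.\<close>

lemma rho_denom_eq:
  "rho_denom \<beta> x y = exp (\<beta> / 4 + \<beta> * (x + y) / 2) / 2 *
     ((1 - exp (- \<beta>)) - (1 - exp (- \<beta> * x)) * (1 - exp (- \<beta> * y)))"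
proof -
  have "exp (\<beta> / 4) * cosh (\<beta> * (x - y) / 2)
      = (exp (\<beta> / 4 + \<beta> * (x - y) / 2) + exp (\<beta> / 4 - \<beta> * (x - y) / 2)) / 2"
    by (simp add: cosh_field_def algebra_simps flip: exp_add)
  moreover have "exp (- \<beta> / 4) * cosh (\<beta> * (x + y - 1) / 2)
      = (exp (\<beta> * (x + y) / 2 + (- 3 * \<beta> / 4)) + exp (\<beta> / 4 - \<beta> * (x + y) / 2)) / 2"
    by (simp add: cosh_field_def algebra_simps add_divide_distrib flip: exp_add)
       (simp add: field_simps)
  moreover have "exp (\<beta> / 4 + \<beta> * (x + y) / 2) *
     ((1 - exp (- \<beta>)) - (1 - exp (- \<beta> * x)) * (1 - exp (- \<beta> * y)))
     = exp (\<beta> / 4 + \<beta> * (x - y) / 2) + exp (\<beta> / 4 - \<beta> * (x - y) / 2)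
       - exp (\<beta> * (x + y) / 2 + (- 3 * \<beta> / 4)) - exp (\<beta> / 4 - \<beta> * (x + y) / 2)"
    by (simp add: algebra_simps add_divide_distrib diff_divide_distrib flip: exp_add)
  ultimately show ?thesis by (simp add: rho_denom_def)
qed

text \<open>With \<open>a\<close>, \<open>b\<close>, \<open>e\<close> for the three exponentials,
  the expression is \<open>a * (1 - b) + (b - e)\<close>. Both terms have the sign of
  \<open>\<beta>\<close> or vanish, and they cannot vanish together because
  \<open>e \<noteq> 1\<close>.\<close>

lemma rho_denom_factor_neq_0:
  fixes \<beta> x y :: real
  assumes "\<beta> \<noteq> 0" "x \<in> {0..1}" "y \<in> {0..1}"
  shows "(1 - exp (- \<beta>)) - (1 - exp (- \<beta> * x)) * (1 - exp (- \<beta> * y)) \<noteq> 0"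
proof -
  define a b e where "a = exp (- \<beta> * x)" and "b = exp (- \<beta> * y)" and "e = exp (- \<beta>)"
  have pos: "a > 0" "b > 0" "e > 0" by (auto simp: a_def b_def e_def)
  have "(1 - e) - (1 - a) * (1 - b) \<noteq> 0"
  proof (cases "\<beta> > 0")
    case True
    then have le: "e \<le> a" "a \<le> 1" "e \<le> b" "b \<le> 1" "e < 1"
      using assms by (auto simp: a_def b_def e_def mult_le_cancel_left1)
    have eq: "(1 - e) - (1 - a) * (1 - b) = a * (1 - b) + (b - e)" by (simp add: algebra_simps)
    have "a * (1 - b) + (b - e) > 0"
    proof (cases "b = 1")
      case False
      then have "a * (1 - b) > 0" using pos le by simp
      then show ?thesis using le by linarith
    qed (use le in simp)
    then show ?thesis using eq by linarith
  next
    case False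
    then have "\<beta> < 0" using assms by simp
    then have le: "a \<le> e" "1 \<le> a" "b \<le> e" "1 \<le> b" "1 < e"
      using assms by (auto simp: a_def b_def e_def mult_le_cancel_left1 mult_le_0_iff)
    have eq: "(1 - e) - (1 - a) * (1 - b) = - (a * (b - 1) + (e - b))" by (simp add: algebra_simps)
    have "a * (b - 1) + (e - b) > 0"
    proof (cases "b = 1")
      case False
      then have "a * (b - 1) > 0" using pos le by simp
      then show ?thesis using le by linarith
    qed (use le in simp)
    then show ?thesis using eq by linarith
  qed
  then show ?thesis by (simp add: a_def b_def e_def)
qed

lemma rho_denom_neq_0:
  "\<beta> \<noteq> 0 \<Longrightarrow> x \<in> {0..1} \<Longrightarrow> y \<in> {0..1} \<Longrightarrow> rho_denom \<beta> x y \<noteq> 0"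
  unfolding rho_denom_eq using rho_denom_factor_neq_0 by simp

lemma rho_numerator_eq:
  "exp (\<beta> * (1 / 2 - x) / 2) * sinh (\<beta> * y / 2)
     = exp (\<beta> / 4 + \<beta> * (x + y) / 2) / 2 * ((1 - exp (- \<beta> * y)) * exp (- \<beta> * x))" for \<beta> x y :: real
proof -
  have "exp (\<beta> * (1 / 2 - x) / 2) * sinh (\<beta> * y / 2)
     = (exp (\<beta> / 4 + \<beta> * y / 2 - \<beta> * x / 2) - exp (\<beta> / 4 - \<beta> * y / 2 - \<beta> * x / 2)) / 2"
    by (simp add: sinh_field_def algebra_simps add_divide_distrib diff_divide_distrib flip: exp_add)
  also have "\<dots> = exp (\<beta> / 4 + \<beta> * (x + y) / 2) / 2 * ((1 - exp (- \<beta> * y)) * exp (- \<beta> * x))"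
    by (simp add: algebra_simps add_divide_distrib diff_divide_distrib flip: exp_add)
  finally show ?thesis .
qed

text \<open>The bracket is \<open>rho_denom \<beta> x 0\<close>. It is what the quotient rule leaves
  for the closed form of \<open>\<rho>\<close>, and the prefactor removes its dependence on
  \<open>x\<close>.\<close>

lemma rho_deriv_numerator:
  "exp (\<beta> * (1 / 2 - x) / 2) * (exp (\<beta> / 4) * cosh (\<beta> * x / 2) - exp (- \<beta> / 4) * cosh (\<beta> * (x - 1) / 2))
    = sinh (\<beta> / 2)" for \<beta> x :: real
  by (simp add: sinh_field_def cosh_field_def algebra_simps add_divide_distrib diff_divide_distrib flip: exp_add)

lemma has_derivative_rho_closed:
  assumes "\<beta> \<noteq> 0" "x \<in> {0..1}" "y \<in> {0..1}"
  shows "((\<lambda>y. exp (\<beta> * (1 / 2 - x) / 2) * sinh (\<beta> * y / 2) / rho_denom \<beta> x y)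
           has_real_derivative mallows_u \<beta> x y) (at y)"
proof -
  let ?D = "rho_denom \<beta> x y"
  have nz: "?D \<noteq> 0" using assms by (rule rho_denom_neq_0)
  define D' where "D' = - (\<beta> / 2) * (exp (\<beta> / 4) * sinh (\<beta> * (x - y) / 2) + exp (- \<beta> / 4) * sinh (\<beta> * (x + y - 1) / 2))"
  have D': "(rho_denom \<beta> x has_real_derivative D') (at y)"
    unfolding rho_denom_def[abs_def] D'_def
    by (auto intro!: derivative_eq_intros simp: algebra_simps)
  \<comment> \<open>The decompositions \<open>x = y + (x - y)\<close> and
    \<open>x - 1 = (x + y - 1) - y\<close> recombine the products of the quotient rule into terms
    free of \<open>y\<close>.\<close>
  have cosh_x: "cosh (\<beta> * x / 2) = cosh (\<beta> * y / 2) * cosh (\<beta> * (x - y) / 2) + sinh (\<beta> * y / 2) * sinh (\<beta> * (x - y) / 2)"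
    using cosh_add[of "\<beta> * y / 2" "\<beta> * (x - y) / 2"] by (simp add: field_simps)
  have cosh_x1: "cosh (\<beta> * (x - 1) / 2) = cosh (\<beta> * (x + y - 1) / 2) * cosh (\<beta> * y / 2) - sinh (\<beta> * (x + y - 1) / 2) * sinh (\<beta> * y / 2)"
    unfolding cosh_diff[symmetric] by (simp add: algebra_simps add_divide_distrib diff_divide_distrib)
  have "cosh (\<beta> * y / 2) * (\<beta> / 2) * ?D - sinh (\<beta> * y / 2) * D'
     = (\<beta> / 2) * (exp (\<beta> / 4) * cosh (\<beta> * x / 2) - exp (- \<beta> / 4) * cosh (\<beta> * (x - 1) / 2))"
    unfolding cosh_x cosh_x1 D'_def rho_denom_def by (simp add: algebra_simps)
  then have num: "exp (\<beta> * (1 / 2 - x) / 2) * (cosh (\<beta> * y / 2) * (\<beta> / 2)) * ?D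
      - exp (\<beta> * (1 / 2 - x) / 2) * sinh (\<beta> * y / 2) * D' = \<beta> / 2 * sinh (\<beta> / 2)"
    using rho_deriv_numerator[of \<beta> x] by algebra
  have "((\<lambda>y. exp (\<beta> * (1 / 2 - x) / 2) * sinh (\<beta> * y / 2)) has_real_derivative
      exp (\<beta> * (1 / 2 - x) / 2) * (cosh (\<beta> * y / 2) * (\<beta> / 2))) (at y)"
    by (auto intro!: derivative_eq_intros)
  from DERIV_divide[OF this D' nz] show ?thesis
    unfolding num using assms(1) by (simp add: mallows_u_def rho_denom_def power2_eq_square)
qed

lemma mallows_rho_eq_sinh:
  assumes "\<beta> \<noteq> 0" "x \<in> {0..1}" "y \<in> {0..1}"
  shows "mallows_rho \<beta> x y = exp (\<beta> * (1 / 2 - x) / 2) * sinh (\<beta> * y / 2) / rho_denom \<beta> x y"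
proof -
  let ?R = "\<lambda>y. exp (\<beta> * (1 / 2 - x) / 2) * sinh (\<beta> * y / 2) / rho_denom \<beta> x y"
  have "(mallows_u \<beta> x has_integral ?R y - ?R 0) {0..y}"
  proof (rule fundamental_theorem_of_calculus)
    fix z assume "z \<in> {0..y}"
    with assms have "(?R has_real_derivative mallows_u \<beta> x z) (at z)"
      by (intro has_derivative_rho_closed) auto
    then show "(?R has_vector_derivative mallows_u \<beta> x z) (at z within {0..y})"
      by (simp add: has_real_derivative_iff_has_vector_derivative has_vector_derivative_at_within)
  qed (use assms in simp)
  then show ?thesis
    unfolding mallows_rho_def by (simp add: integral_unique)
qed

lemma mallows_rho_eq_exp:
  assumes "\<beta> \<noteq> 0" "x \<in> {0..1}" "y \<in> {0..1}"
  shows "mallows_rho \<beta> x y = (1 - exp (- \<beta> * y)) * exp (- \<beta> * x) /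
            ((1 - exp (- \<beta>)) - (1 - exp (- \<beta> * x)) * (1 - exp (- \<beta> * y)))"
  unfolding mallows_rho_eq_sinh[OF assms] rho_denom_eq rho_numerator_eq
  using rho_denom_factor_neq_0[OF assms] by simp

section \<open>The case \<open>\<beta> = 0\<close> as a limit\<close>

lemma mallows_rho_0: "0 \<le> y \<Longrightarrow> mallows_rho 0 x y = y"
  by (simp add: mallows_rho_def mallows_u_def)

text \<open>The denominator vanishes at \<open>b = 0\<close>, so the limit is its derivative there:
  each exponential contributes 1/4, and the hyperbolic cosines have derivative 0.\<close>

lemma rho_denom_limit: "((\<lambda>b. rho_denom b x y / b) \<longlongrightarrow> 1 / 2) (at 0)"
proof -
  have "((\<lambda>b. rho_denom b x y) has_real_derivative 1 / 2) (at 0)"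
    unfolding rho_denom_def by (auto intro!: derivative_eq_intros)
  then show ?thesis
    by (simp add: DERIV_def rho_denom_def)
qed

lemma sinh_limit: "((\<lambda>b. sinh (b * c / 2) / b) \<longlongrightarrow> c / 2) (at (0 :: real))"
proof -
  have "((\<lambda>b. sinh (b * c / 2)) has_real_derivative c / 2) (at 0)"
    by (auto intro!: derivative_eq_intros)
  then show ?thesis
    by (simp add: DERIV_def)
qed

lemma mallows_u_limit: "((\<lambda>b. mallows_u b x y) \<longlongrightarrow> 1) (at 0)"
proof -
  have "((\<lambda>b. (1 / 2) * (sinh (b * 1 / 2) / b) / (rho_denom b x y / b) ^ 2) \<longlongrightarrow> (1 / 2) * (1 / 2) / (1 / 2) ^ 2) (at 0)"
    by (intro tendsto_intros sinh_limit rho_denom_limit) auto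
  moreover have "\<forall>\<^sub>F b in at 0. (1 / 2) * (sinh (b * 1 / 2) / b) / (rho_denom b x y / b) ^ 2 = mallows_u b x y"
    using eventually_neq_at_within[of 0]
    by eventually_elim (simp add: mallows_u_def rho_denom_def power2_eq_square)
  ultimately show ?thesis
    by (auto simp: power2_eq_square intro: Lim_transform_eventually)
qed

lemma mallows_rho_limit:
  assumes "x \<in> {0..1}" "y \<in> {0..1}"
  shows "((\<lambda>b. mallows_rho b x y) \<longlongrightarrow> y) (at 0)"
proof -
  have "((\<lambda>b. exp (b * (1 / 2 - x) / 2) * (sinh (b * y / 2) / b) / (rho_denom b x y / b))
          \<longlongrightarrow> exp (0 * (1 / 2 - x) / 2) * (y / 2) / (1 / 2)) (at 0)"
    by (intro tendsto_intros sinh_limit rho_denom_limit) auto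
  moreover have "\<forall>\<^sub>F b in at 0. exp (b * (1 / 2 - x) / 2) * (sinh (b * y / 2) / b) / (rho_denom b x y / b) = mallows_rho b x y"
    using eventually_neq_at_within[of 0]
    by eventually_elim (simp add: mallows_rho_eq_sinh assms[simplified])
  ultimately show ?thesis
    by (auto intro: Lim_transform_eventually)
qed

section \<open>The density as the derivative of the limiting profile\<close>

lemma mallows_rho_eq_remaining:
  fixes \<beta> x y :: real
  assumes "\<beta> \<noteq> 0" "x \<in> {0..1}" "y \<in> {0..1}"
  shows "mallows_rho \<beta> x y = exp (\<beta> * (1 - x)) * ((exp (\<beta> * y) - 1) / (exp \<beta> - 1)) /
     (1 + (exp (\<beta> * (1 - x)) - 1) * (exp (\<beta> * y) - 1) / (exp \<beta> - 1))"
proof -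
  define a t g where "a = exp (- \<beta> * x)" and "t = exp (\<beta> * y)" and "g = exp \<beta>"
  have nz: "t \<noteq> 0" "g \<noteq> 0" "g - 1 \<noteq> 0" using assms by (auto simp: t_def g_def)
  have exps: "exp (- \<beta> * y) = 1 / t" "exp (- \<beta>) = 1 / g" "exp (\<beta> * (1 - x)) = g * a"
    by (simp_all add: a_def t_def g_def exp_minus field_simps flip: exp_add)
  define W where "W = 1 + (g * a - 1) * (t - 1) / (g - 1)"
  \<comment> \<open>Expanding by \<open>t * g\<close> clears the inverse exponentials and exposes
    \<open>W\<close>, the argument of the logarithm in \<open>remaining\<close>; the quotient then
    has the shape of a logarithmic derivative.\<close>
  have "(1 - 1 / t) * a / ((1 - 1 / g) - (1 - a) * (1 - 1 / t))
     = ((t * g) * ((1 - 1 / t) * a)) / ((t * g) * ((1 - 1 / g) - (1 - a) * (1 - 1 / t)))"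
    using nz by simp
  also have "(t * g) * ((1 - 1 / t) * a) = (g - 1) * (g * a * ((t - 1) / (g - 1)))"
    using nz by (simp add: field_simps)
  also have "(t * g) * ((1 - 1 / g) - (1 - a) * (1 - 1 / t)) = (g - 1) * W"
  proof -
    have "(t * g) * ((1 - 1 / g) - (1 - a) * (1 - 1 / t)) = (g - 1) + (g * a - 1) * (t - 1)"
      using nz by (simp add: field_simps)
    also have "\<dots> = (g - 1) * W" using nz by (simp add: W_def distrib_left)
    finally show ?thesis .
  qed
  finally show ?thesis
    unfolding mallows_rho_eq_exp[OF assms] exps using nz
    by (simp add: W_def a_def t_def g_def)
qed

lemma mallows_rho_nonneg:
  assumes "x \<in> {0..1}" "y \<in> {0..1}"
  shows "0 \<le> mallows_rho \<beta> x y"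
proof (cases "\<beta> = 0")
  case True
  with assms show ?thesis by (simp add: mallows_rho_0)
next
  case False
  have "0 \<le> (exp (\<beta> * y) - 1) / (exp \<beta> - 1)"
    using assms by (auto simp: zero_le_divide_iff mult_nonneg_nonneg mult_le_0_iff zero_le_mult_iff)
  then show ?thesis
    unfolding mallows_rho_eq_remaining[OF False assms]
    using remaining_arg_bounds(1)[OF False assms]
    by (intro divide_nonneg_pos[OF mult_nonneg_nonneg[OF exp_ge_zero]])
qed

lemma continuous_on_mallows_rho:
  assumes "y \<in> {0..1}"
  shows "continuous_on {0..1} (\<lambda>x. mallows_rho \<beta> x y)"
proof (cases "\<beta> = 0")
  case True
  with assms show ?thesis by (simp add: mallows_rho_0)
next
  case False
  have "continuous_on {0..1} (\<lambda>x. exp (\<beta> * (1 - x)) * ((exp (\<beta> * y) - 1) / (exp \<beta> - 1)) /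
     (1 + (exp (\<beta> * (1 - x)) - 1) * (exp (\<beta> * y) - 1) / (exp \<beta> - 1)))"
    using remaining_arg_bounds(1)[OF False _ assms] False
    by (intro continuous_intros) (auto simp: less_imp_neq[symmetric])
  then show ?thesis
    by (rule continuous_on_eq) (simp add: mallows_rho_eq_remaining[OF False _ assms])
qed

lemma has_derivative_remaining:
  assumes "x \<in> {0..1}" "y \<in> {0..1}"
  shows "((\<lambda>x. y - remaining \<beta> y x) has_real_derivative mallows_rho \<beta> x y) (at x)"
proof (cases "\<beta> = 0")
  case True
  with assms show ?thesis
    by (auto simp: remaining_def mallows_rho_0 intro!: derivative_eq_intros)
next
  case False
  define c where "c = (exp (\<beta> * y) - 1) / (exp \<beta> - 1)"
  have "1 + (exp (\<beta> * (1 - x)) - 1) * c > 0"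
    using remaining_arg_bounds(1)[OF False assms] by (simp add: c_def)
  moreover have "((\<lambda>x. 1 + (exp (\<beta> * (1 - x)) - 1) * c) has_real_derivative - \<beta> * exp (\<beta> * (1 - x)) * c) (at x)"
    by (auto intro!: derivative_eq_intros)
  ultimately have "((\<lambda>x. y - ln (1 + (exp (\<beta> * (1 - x)) - 1) * c) / \<beta>) has_real_derivative
      0 - 1 / (1 + (exp (\<beta> * (1 - x)) - 1) * c) * (- \<beta> * exp (\<beta> * (1 - x)) * c) / \<beta>) (at x)"
    by (intro DERIV_diff DERIV_const DERIV_cdivide DERIV_chain2[OF DERIV_ln_divide])
  then have "((\<lambda>x. y - ln (1 + (exp (\<beta> * (1 - x)) - 1) * c) / \<beta>) has_real_derivative
      exp (\<beta> * (1 - x)) * c / (1 + (exp (\<beta> * (1 - x)) - 1) * c)) (at x)"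
    using False by simp
  then show ?thesis
    using False by (simp add: remaining_def mallows_rho_eq_remaining[OF False assms] c_def)
qed

lemma mallows_rho_has_integral:
  assumes "0 \<le> a" "a \<le> b" "b \<le> 1" "y \<in> {0..1}"
  shows "((\<lambda>x. mallows_rho \<beta> x y) has_integral remaining \<beta> y a - remaining \<beta> y b) {a..b}"
proof -
  have "((\<lambda>x. mallows_rho \<beta> x y) has_integral (y - remaining \<beta> y b) - (y - remaining \<beta> y a)) {a..b}"
  proof (rule fundamental_theorem_of_calculus[OF assms(2)])
    fix x assume "x \<in> {a..b}"
    then have "((\<lambda>x. y - remaining \<beta> y x) has_real_derivative mallows_rho \<beta> x y) (at x)"
      using assms by (intro has_derivative_remaining) auto
    then show "((\<lambda>x. y - remaining \<beta> y x) has_vector_derivative mallows_rho \<beta> x y) (at x within {a..b})"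
      by (simp add: has_real_derivative_iff_has_vector_derivative has_vector_derivative_at_within)
  qed
  then show ?thesis by simp
qed

lemma remaining_0: "y \<in> {0..1} \<Longrightarrow> remaining \<beta> y 0 = y"
  by (simp add: remaining_def)

section \<open>Continuous test functions\<close>

text \<open>\<open>H\<close> is a cumulative mass and \<open>I\<close> the cumulative mass weighted
  by \<open>f\<close>. The errors of the cells telescope to \<open>\<omega>\<close> times the total
  mass. The statement is abstract because it serves both for the random configuration and for the
  density \<open>\<rho>\<close>.\<close>

lemma block_sum_bound:
  fixes f H I :: "real \<Rightarrow> real"
  assumes "M > 0"
    and block: "\<And>a b. 0 \<le> a \<Longrightarrow> a \<le> b \<Longrightarrow> b \<le> 1 \<Longrightarrow> b - a \<le> 1 / real M \<Longrightarrow>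
       \<bar>I b - I a - f a * (H b - H a)\<bar> \<le> \<omega> * (H b - H a)"
    and "I 0 = 0" "H 0 = 0"
  shows "\<bar>I 1 - (\<Sum>j<M. f (real j / real M) * (H (real (Suc j) / real M) - H (real j / real M)))\<bar> \<le> \<omega> * H 1"
proof -
  let ?x = "\<lambda>j. real j / real M"
  have I: "I 1 = (\<Sum>j<M. I (?x (Suc j)) - I (?x j))"
    using assms by (subst sum_lessThan_telescope) simp
  have H: "H 1 = (\<Sum>j<M. H (?x (Suc j)) - H (?x j))"
    using assms by (subst sum_lessThan_telescope) simp
  have "\<bar>I 1 - (\<Sum>j<M. f (?x j) * (H (?x (Suc j)) - H (?x j)))\<bar>
     = \<bar>\<Sum>j<M. I (?x (Suc j)) - I (?x j) - f (?x j) * (H (?x (Suc j)) - H (?x j))\<bar>"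
    by (simp only: I sum_subtractf)
  also have "\<dots> \<le> (\<Sum>j<M. \<bar>I (?x (Suc j)) - I (?x j) - f (?x j) * (H (?x (Suc j)) - H (?x j))\<bar>)"
    by (rule sum_abs)
  also have "\<dots> \<le> (\<Sum>j<M. \<omega> * (H (?x (Suc j)) - H (?x j)))"
  proof (rule sum_mono)
    fix j assume "j \<in> {..<M}"
    then show "\<bar>I (?x (Suc j)) - I (?x j) - f (?x j) * (H (?x (Suc j)) - H (?x j))\<bar> \<le> \<omega> * (H (?x (Suc j)) - H (?x j))"
      using assms(1) by (intro block) (auto simp: divide_right_mono field_simps)
  qed
  also have "\<dots> = \<omega> * H 1"
    unfolding H sum_distrib_left ..
  finally show ?thesis .
qed

lemma occupation_block:
  fixes f :: "real \<Rightarrow> real" and \<pi> :: "nat \<Rightarrow> nat" and k :: nat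
  assumes "N > 0" "0 \<le> a" "a \<le> b" "b \<le> 1"
    and osc: "\<And>u. a \<le> u \<Longrightarrow> u \<le> b \<Longrightarrow> \<bar>f u - f a\<bar> \<le> \<omega>"
  defines "I \<equiv> \<lambda>x. (\<Sum>j=1..nat \<lfloor>x * real N\<rfloor>. f (real j / real N) * particle_config k \<pi> j) / real N"
  shows "\<bar>I b - I a - f a * (occupation N k \<pi> b - occupation N k \<pi> a)\<bar>
       \<le> \<omega> * (occupation N k \<pi> b - occupation N k \<pi> a)"
proof -
  define i j where "i = nat \<lfloor>a * real N\<rfloor>" and "j = nat \<lfloor>b * real N\<rfloor>"
  have "i \<le> j" unfolding i_def j_def using assms by (intro nat_mono floor_mono mult_right_mono) auto
  then have split: "(\<Sum>l=1..j. h l) = (\<Sum>l=1..i. h l) + (\<Sum>l=Suc i..j. h l)" for h :: "nat \<Rightarrow> real"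
    by (subst sum.union_disjoint[symmetric]) (auto intro!: sum.cong)
  have Ho: "occupation N k \<pi> b - occupation N k \<pi> a = (\<Sum>l=Suc i..j. particle_config k \<pi> l) / real N"
    unfolding occupation_def i_def[symmetric] j_def[symmetric] split by (simp add: add_divide_distrib)
  have Io: "I b - I a = (\<Sum>l=Suc i..j. f (real l / real N) * particle_config k \<pi> l) / real N"
    unfolding I_def i_def[symmetric] j_def[symmetric] split by (simp add: add_divide_distrib)
  have "I b - I a - f a * (occupation N k \<pi> b - occupation N k \<pi> a)
      = (\<Sum>l=Suc i..j. (f (real l / real N) - f a) * particle_config k \<pi> l) / real N"
    unfolding Ho Io by (simp add: sum_distrib_left left_diff_distrib sum_subtractf diff_divide_distrib)
  then have "\<bar>I b - I a - f a * (occupation N k \<pi> b - occupation N k \<pi> a)\<bar>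
      = \<bar>\<Sum>l=Suc i..j. (f (real l / real N) - f a) * particle_config k \<pi> l\<bar> / real N"
    by (simp add: abs_divide)
  also have "\<dots> \<le> (\<Sum>l=Suc i..j. \<omega> * particle_config k \<pi> l) / real N"
  proof (intro divide_right_mono order_trans[OF sum_abs] sum_mono)
    fix l assume l: "l \<in> {Suc i..j}"
    have "a \<le> real l / real N" "real l / real N \<le> b"
    proof -
      \<comment> \<open>A block consists of the sites after \<open>\<lfloor>a * N\<rfloor>\<close>
        up to \<open>\<lfloor>b * N\<rfloor>\<close>: adjacent blocks are disjoint, and all rescaled
        sites stay in \<open>{a..b}\<close>, where the oscillation of \<open>f\<close> is
        controlled.\<close>
      have "\<lfloor>a * real N\<rfloor> < int l" using l by (auto simp: i_def)
      then have "a * real N \<le> real l" by linarith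
      then show "a \<le> real l / real N" using \<open>N > 0\<close> by (simp add: field_simps)
      have "int l \<le> \<lfloor>b * real N\<rfloor>" using l assms(2,3) by (auto simp: j_def)
      then have "real l \<le> b * real N" by linarith
      then show "real l / real N \<le> b" using \<open>N > 0\<close> by (simp add: field_simps)
    qed
    from osc[OF this] show "\<bar>(f (real l / real N) - f a) * particle_config k \<pi> l\<bar> \<le> \<omega> * particle_config k \<pi> l"
      by (simp add: particle_config_def)
  qed simp
  also have "\<dots> = \<omega> * (occupation N k \<pi> b - occupation N k \<pi> a)"
    unfolding Ho by (simp add: sum_distrib_left)
  finally show ?thesis .
qed

lemma integral_rho_block:
  fixes f :: "real \<Rightarrow> real"
    and \<beta> :: real
  assumes f: "continuous_on {0..1} f" and y: "y \<in> {0..1}" and ab: "0 \<le> a" "a \<le> b" "b \<le> 1"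
    and osc: "\<And>u. a \<le> u \<Longrightarrow> u \<le> b \<Longrightarrow> \<bar>f u - f a\<bar> \<le> \<omega>"
  defines "I \<equiv> \<lambda>x. integral {0..x} (\<lambda>x. f x * mallows_rho \<beta> x y)"
    and "H \<equiv> \<lambda>x. y - remaining \<beta> y x"
  shows "\<bar>I b - I a - f a * (H b - H a)\<bar> \<le> \<omega> * (H b - H a)"
proof -
  let ?\<rho> = "\<lambda>x. mallows_rho \<beta> x y"
  have cont: "continuous_on {0..1} (\<lambda>x. f x * ?\<rho> x)"
    by (intro continuous_intros f continuous_on_mallows_rho y)
  then have int: "(\<lambda>x. f x * ?\<rho> x) integrable_on {c..d}" if "0 \<le> c" "d \<le> 1" for c d
    by (intro integrable_continuous_real) (rule continuous_on_subset, use that in auto)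
  have \<rho>: "(?\<rho> has_integral H b - H a) {a..b}"
    using mallows_rho_has_integral[OF ab y, of \<beta>] by (simp add: H_def)
  have "I b - I a = integral {a..b} (\<lambda>x. f x * ?\<rho> x)"
    using Henstock_Kurzweil_Integration.integral_combine[OF ab(1,2) int[of 0 b]] ab by (simp add: I_def)
  then have 1: "((\<lambda>x. f x * ?\<rho> x) has_integral I b - I a) {a..b}"
    using int[of a b] ab by (simp add: has_integral_integral)
  have "((\<lambda>x. f x * ?\<rho> x - f a * ?\<rho> x) has_integral I b - I a - f a * (H b - H a)) {a..b}"
    by (intro has_integral_diff 1 has_integral_mult_right \<rho>)
  moreover have "((\<lambda>x. \<omega> * ?\<rho> x) has_integral \<omega> * (H b - H a)) {a..b}"
    by (intro has_integral_mult_right \<rho>)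
  moreover have "norm (f x * ?\<rho> x - f a * ?\<rho> x) \<le> \<omega> * ?\<rho> x" if "x \<in> {a..b}" for x
  proof -
    have "0 \<le> ?\<rho> x" using that ab y by (intro mallows_rho_nonneg) auto
    moreover have "\<bar>f x - f a\<bar> \<le> \<omega>" using that by (intro osc) auto
    ultimately show ?thesis
      by (simp add: left_diff_distrib[symmetric] abs_mult mult_right_mono)
  qed
  ultimately have "norm (I b - I a - f a * (H b - H a)) \<le> \<omega> * (H b - H a)"
    by (metis (no_types, lifting) has_integral_integrable_integral integral_norm_bound_integral)
  then show ?thesis by simp
qed

text \<open>On a grid fixed independently of \<open>N\<close>, the random sum and the integral are
  both replaced by the functional \<open>?S\<close>, applied to the empirical profile
  \<open>G\<close> and to its limit \<open>H\<close>. These differ only through the values at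
  finitely many grid points, where \<open>occupation_limit\<close> applies.\<close>

lemma empirical_mean_limit:
  fixes f :: "real \<Rightarrow> real" and \<beta> y :: real
  assumes f: "continuous_on {0..1} f" and y: "0 \<le> y" "y \<le> 1"
  shows "(\<lambda>N. mallows_expectation N (1 - \<beta> / real N) (\<lambda>\<pi>.
     \<bar>(1 / real N) * (\<Sum>i = 1..N. f (real i / real N) * particle_config (nat \<lfloor>y * real N\<rfloor>) \<pi> i)
        - integral {0..1} (\<lambda>x. f x * mallows_rho \<beta> x y)\<bar>)) \<longlonglongrightarrow> 0"
proof -
  let ?E = "\<lambda>N. mallows_expectation N (1 - \<beta> / real N)"
  let ?Z = "\<lambda>N \<pi>. \<bar>(1 / real N) * (\<Sum>i = 1..N. f (real i / real N) * particle_config (nat \<lfloor>y * real N\<rfloor>) \<pi> i)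
        - integral {0..1} (\<lambda>x. f x * mallows_rho \<beta> x y)\<bar>"
  show "(\<lambda>N. ?E N (?Z N)) \<longlonglongrightarrow> 0"
  proof (rule LIMSEQ_I)
    fix e :: real assume "e > 0"
    \<comment> \<open>Two discretisation errors and the eventual grid error cost at most
      \<open>\<omega>\<close> each, so the total stays below \<open>e\<close>.\<close>
    define \<omega> where "\<omega> = e / 4"
    have \<omega>: "\<omega> > 0" using \<open>e > 0\<close> by (simp add: \<omega>_def)
    have yI: "y \<in> {0..1}" using y by simp
    have "uniformly_continuous_on {0..1} f"
      by (intro compact_uniformly_continuous f) simp
    then obtain \<delta> where \<delta>: "\<delta> > 0"
      "\<And>u v. u \<in> {0..1} \<Longrightarrow> v \<in> {0..1} \<Longrightarrow> dist v u < \<delta> \<Longrightarrow> dist (f v) (f u) < \<omega>"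
      unfolding uniformly_continuous_on_def using \<omega> by blast
    obtain M :: nat where M: "M > 0" "1 / real M < \<delta>"
      using ex_inverse_of_nat_less[OF \<delta>(1)] by (auto simp: inverse_eq_divide)
    have osc: "\<bar>f u - f a\<bar> \<le> \<omega>" if "0 \<le> a" "b \<le> 1" "b - a \<le> 1 / real M" "a \<le> u" "u \<le> b" for a b u
      using \<delta>(2)[of a u] that M by (auto simp: dist_real_def)
    define H where "H = (\<lambda>x. y - remaining \<beta> y x)"
    define G where "G = (\<lambda>N. occupation N (nat \<lfloor>y * real N\<rfloor>))"
    let ?x = "\<lambda>j. real j / real M"
    let ?S = "\<lambda>K. \<Sum>j<M. f (?x j) * (K (?x (Suc j)) - K (?x j))"
    let ?J = "integral {0..1} (\<lambda>x. f x * mallows_rho \<beta> x y)"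
    have "\<bar>?J - ?S H\<bar> \<le> \<omega> * H 1"
    proof (rule block_sum_bound[OF M(1), where I = "\<lambda>x. integral {0..x} (\<lambda>x. f x * mallows_rho \<beta> x y)"])
      fix a b :: real assume "0 \<le> a" "a \<le> b" "b \<le> 1" "b - a \<le> 1 / real M"
      then show "\<bar>integral {0..b} (\<lambda>x. f x * mallows_rho \<beta> x y) - integral {0..a} (\<lambda>x. f x * mallows_rho \<beta> x y) - f a * (H b - H a)\<bar> \<le> \<omega> * (H b - H a)"
        unfolding H_def by (intro integral_rho_block f yI) (auto intro: osc)
    qed (use yI in \<open>auto simp: H_def remaining_0\<close>)
    also have "\<dots> \<le> \<omega>" using \<omega> y by (simp add: H_def remaining_1)
    finally have J: "\<bar>?J - ?S H\<bar> \<le> \<omega>" .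
    define D where "D = (\<lambda>N x \<pi>. \<bar>G N \<pi> x - H x\<bar>)"
    have Z: "?Z N \<pi> \<le> 2 * \<omega> + (\<Sum>j<M. \<bar>f (?x j)\<bar> * (D N (?x (Suc j)) \<pi> + D N (?x j) \<pi>))" if "N > 0" for N \<pi>
    proof -
      let ?k = "nat \<lfloor>y * real N\<rfloor>"
      let ?I = "\<lambda>x. (\<Sum>j=1..nat \<lfloor>x * real N\<rfloor>. f (real j / real N) * particle_config ?k \<pi> j) / real N"
      have "\<bar>?I 1 - ?S (G N \<pi>)\<bar> \<le> \<omega> * G N \<pi> 1"
      proof (rule block_sum_bound[OF M(1), where I = ?I])
        fix a b :: real assume "0 \<le> a" "a \<le> b" "b \<le> 1" "b - a \<le> 1 / real M"
        then show "\<bar>?I b - ?I a - f a * (G N \<pi> b - G N \<pi> a)\<bar> \<le> \<omega> * (G N \<pi> b - G N \<pi> a)"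
          unfolding G_def using that by (intro occupation_block) (auto intro: osc)
      qed (auto simp: G_def occupation_def)
      also have "\<dots> \<le> \<omega>"
      proof -
        have "(\<Sum>j=1..N. particle_config ?k \<pi> j) \<le> (\<Sum>j=1..N. 1)"
          by (rule sum_mono) (simp add: particle_config_def)
        then have "G N \<pi> 1 \<le> 1" using that by (simp add: G_def occupation_def)
        then show ?thesis using \<omega> by simp
      qed
      finally have I: "\<bar>?I 1 - ?S (G N \<pi>)\<bar> \<le> \<omega>" .
      have "?S (G N \<pi>) - ?S H
          = (\<Sum>j<M. f (?x j) * ((G N \<pi> (?x (Suc j)) - H (?x (Suc j))) - (G N \<pi> (?x j) - H (?x j))))"
        unfolding sum_subtractf[symmetric] by (rule sum.cong) (simp_all add: algebra_simps)
      then have "\<bar>?S (G N \<pi>) - ?S H\<bar>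
          \<le> (\<Sum>j<M. \<bar>f (?x j) * ((G N \<pi> (?x (Suc j)) - H (?x (Suc j))) - (G N \<pi> (?x j) - H (?x j)))\<bar>)"
        by (simp only: sum_abs)
      also have "\<dots> \<le> (\<Sum>j<M. \<bar>f (?x j)\<bar> * (D N (?x (Suc j)) \<pi> + D N (?x j) \<pi>))"
        unfolding D_def abs_mult
        by (rule sum_mono) (rule mult_left_mono[OF abs_triangle_ineq4 abs_ge_zero])
      finally have "\<bar>?S (G N \<pi>) - ?S H\<bar> \<le> (\<Sum>j<M. \<bar>f (?x j)\<bar> * (D N (?x (Suc j)) \<pi> + D N (?x j) \<pi>))" .
      moreover have "?Z N \<pi> = \<bar>?I 1 - ?J\<bar>" by simp
      ultimately show ?thesis using I J by linarith
    qed
    have D_lim: "(\<lambda>N. ?E N (D N (?x j))) \<longlonglongrightarrow> 0" if "j \<le> M" for j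
      unfolding D_def G_def H_def using that M y by (intro occupation_limit) auto
    have "(\<lambda>N. \<Sum>j<M. \<bar>f (?x j)\<bar> * (?E N (D N (?x (Suc j))) + ?E N (D N (?x j))))
        \<longlonglongrightarrow> (\<Sum>j<M. \<bar>f (?x j)\<bar> * (0 + 0))"
      by (intro tendsto_intros D_lim) auto
    then have "(\<lambda>N. \<Sum>j<M. \<bar>f (?x j)\<bar> * (?E N (D N (?x (Suc j))) + ?E N (D N (?x j)))) \<longlonglongrightarrow> 0" by simp
    from order_tendstoD(2)[OF this \<omega>]
    have "\<forall>\<^sub>F N in sequentially. norm (?E N (?Z N) - 0) < e"
      using eventually_weight_pos[of \<beta>] eventually_gt_at_top[of 0]
    proof eventually_elim
      case (elim N)
      have "?E N (?Z N) \<le> ?E N (\<lambda>\<pi>. 2 * \<omega> + (\<Sum>j<M. \<bar>f (?x j)\<bar> * (D N (?x (Suc j)) \<pi> + D N (?x j) \<pi>)))"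
        by (rule mallows_expectation_mono[OF elim(2) Z[OF elim(3)]])
      also have "\<dots> = 2 * \<omega> + (\<Sum>j<M. \<bar>f (?x j)\<bar> * (?E N (D N (?x (Suc j))) + ?E N (D N (?x j))))"
        by (simp only: mallows_expectation_add mallows_expectation_const[OF elim(2)]
            mallows_expectation_sum mallows_expectation_cmult)
      also have "\<dots> < e" using elim(1) \<omega> by (simp add: \<omega>_def)
      finally show ?case
        using mallows_expectation_nonneg[OF elim(2), of N "?Z N"] by simp
    qed
    then show "\<exists>no. \<forall>n\<ge>no. norm (?E n (?Z n) - 0) < e"
      by (simp add: eventually_sequentially)
  qed
qed

theorem mainTheorem2:
  fixes \<beta> y :: real
  assumes "0 \<le> y" and "y \<le> 1"
  shows
    "(\<forall>f :: real \<Rightarrow> real. continuous_on {0..1} f \<longrightarrow>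
        (\<exists>L :: real \<Rightarrow> real.
           (\<forall>\<epsilon>>0.
              (\<lambda>N. measure (mallows N (1 - \<beta> / real N))
                 {\<pi> \<in> space (mallows N (1 - \<beta> / real N)).
                    \<bar>(1 / real N) * (\<Sum>i = 1..N. f (real i / real N)
                          * particle_config (nat \<lfloor>y * real N\<rfloor>) \<pi> i)
                      - integral {0..1} (\<lambda>x. f x * mallows_rho \<beta> x y)\<bar> > \<epsilon>})
              \<longlonglongrightarrow> L \<epsilon>) \<and>
           (L \<longlongrightarrow> 0) (at_right 0)))
     \<and> (\<forall>x\<in>{0..1}. \<beta> \<noteq> 0 \<longrightarrow>
          mallows_rho \<beta> x y =
            (1 - exp (- \<beta> * y)) * exp (- \<beta> * x) /
            ((1 - exp (- \<beta>)) - (1 - exp (- \<beta> * x)) * (1 - exp (- \<beta> * y))) \<and>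
          mallows_rho \<beta> x y =
            exp (\<beta> * (1 / 2 - x) / 2) * sinh (\<beta> * y / 2) /
            (exp (\<beta> / 4) * cosh (\<beta> * (x - y) / 2)
             - exp (- \<beta> / 4) * cosh (\<beta> * (x + y - 1) / 2)))
     \<and> (\<forall>x\<in>{0..1}.
          mallows_u 0 x y = 1 \<and> mallows_rho 0 x y = y \<and>
          ((\<lambda>b. mallows_u b x y) \<longlongrightarrow> 1) (at 0) \<and>
          ((\<lambda>b. mallows_rho b x y) \<longlongrightarrow> y) (at 0))"
proof (intro conjI ballI impI allI)
  fix f :: "real \<Rightarrow> real" assume f: "continuous_on {0..1} f"
  let ?Z = "\<lambda>N \<pi>. (1 / real N) * (\<Sum>i = 1..N. f (real i / real N) * particle_config (nat \<lfloor>y * real N\<rfloor>) \<pi> i)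
                      - integral {0..1} (\<lambda>x. f x * mallows_rho \<beta> x y)"
  have "(\<lambda>N. measure (mallows N (1 - \<beta> / real N)) {\<pi> \<in> space (mallows N (1 - \<beta> / real N)). \<bar>?Z N \<pi>\<bar> > \<epsilon>}) \<longlonglongrightarrow> 0"
    if "\<epsilon> > 0" for \<epsilon>
  proof (rule tendsto_sandwich[OF _ _ tendsto_const])
    show "(\<lambda>N. mallows_expectation N (1 - \<beta> / real N) (\<lambda>\<pi>. \<bar>?Z N \<pi>\<bar>) / \<epsilon>) \<longlonglongrightarrow> 0"
      using tendsto_divide[OF empirical_mean_limit[OF f assms, of \<beta>] tendsto_const[of \<epsilon>]] that
      by (simp only: div_0)
    show "\<forall>\<^sub>F N in sequentially.
        measure (mallows N (1 - \<beta> / real N)) {\<pi> \<in> space (mallows N (1 - \<beta> / real N)). \<bar>?Z N \<pi>\<bar> > \<epsilon>}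
        \<le> mallows_expectation N (1 - \<beta> / real N) (\<lambda>\<pi>. \<bar>?Z N \<pi>\<bar>) / \<epsilon>"
      using eventually_weight_pos[of \<beta>] by eventually_elim (rule mallows_markov, use that in auto)
  qed simp
  then show "\<exists>L :: real \<Rightarrow> real. (\<forall>\<epsilon>>0. (\<lambda>N. measure (mallows N (1 - \<beta> / real N))
                 {\<pi> \<in> space (mallows N (1 - \<beta> / real N)). \<bar>?Z N \<pi>\<bar> > \<epsilon>}) \<longlonglongrightarrow> L \<epsilon>) \<and>
           (L \<longlongrightarrow> 0) (at_right 0)"
    \<comment> \<open>The inner limit is already 0 for every positive \<open>\<epsilon>\<close>, so
      the zero function is the witness.\<close>
    by (intro exI[of _ "\<lambda>_. 0"] conjI allI impI tendsto_const)
next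
  fix x :: real assume x: "x \<in> {0..1}"
  have y: "y \<in> {0..1}" using assms by simp
  show "((\<lambda>b. mallows_rho b x y) \<longlongrightarrow> y) (at 0)" by (rule mallows_rho_limit[OF x y])
  show "mallows_u 0 x y = 1" by (simp add: mallows_u_def)
  show "mallows_rho 0 x y = y" by (rule mallows_rho_0[OF assms(1)])
  show "((\<lambda>b. mallows_u b x y) \<longlongrightarrow> 1) (at 0)" by (rule mallows_u_limit)
  assume "\<beta> \<noteq> 0"
  then show "mallows_rho \<beta> x y = (1 - exp (- \<beta> * y)) * exp (- \<beta> * x) /
            ((1 - exp (- \<beta>)) - (1 - exp (- \<beta> * x)) * (1 - exp (- \<beta> * y)))"
    and "mallows_rho \<beta> x y = exp (\<beta> * (1 / 2 - x) / 2) * sinh (\<beta> * y / 2) /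
            (exp (\<beta> / 4) * cosh (\<beta> * (x - y) / 2) - exp (- \<beta> / 4) * cosh (\<beta> * (x + y - 1) / 2))"
    using mallows_rho_eq_exp[of \<beta>, OF _ x y] mallows_rho_eq_sinh[of \<beta>, OF _ x y]
    unfolding rho_denom_def by blast+
qed

end
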